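(* Let $\psi \in L^\infty(\mathbb{T})$ be defined by $\psi(e^{it}) = i e^{-it}(\pi - t)$ for $t \in [0, 2\pi)$, so that the Hankel operator $H_\psi$ on $H^2(\mathbb{D})$ is represented, with respect to the orthonormal basis $\{z^n\}_{n \ge 0}$, by the Hilbert–Hankel matrix $\left[\frac{1}{i+j+1}\right]_{i,j \ge 0}$. Then the operator $$M^S_{S^*}(H_\psi) = \begin{bmatrix} S & H_\psi \\ 0 & S^* \end{bmatrix}$$ on $H^2(\mathbb{D}) \oplus H^2(\mathbb{D})$ is not similar to a contraction.
   Context: $\mathbb{D}$ is the open unit disc in $\mathbb{C}$, $\mathbb{T} = \partial\mathbb{D}$. $H^2(\mathbb{D})$ is the scalar-valued Hardy space, viewed via boundary values as a closed subspace of $L^2(\mathbb{T})$ (normalized Lebesgue measure), and $S$ is the shift on $H^2(\mathbb{D})$, $(Sf)(z) = z f(z)$. For $\varphi \in L^\infty(\mathbb{T})$, the Hankel operator on $H^2(\mathbb{D})$ is $H_\varphi f = P_{H^2(\mathbb{D})}(\varphi\, Jf)$, where $(Jf)(z) = f(\bar z)$ and $P_{H^2(\mathbb{D})}$ is the orthogonal projection of $L^2(\mathbb{T})$ onto $H^2(\mathbb{D})$. A bounded operator $T$ on a Hilbert space is a contraction if $\|T\| \le 1$, and is similar to a contraction if there is a bounded invertible operator $W$ such that $W^{-1} T W$ is a contraction. *)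

theory Defs
  imports "HOL-Complex_Analysis.Complex_Analysis"
begin

section \<open>Operators on complex inner product spaces\<close>

text \<open>The inner product is linear in its first argument.  The superclass supplies the norm
  and the topology, so that the library notions \<^const>\<open>bounded_linear\<close> and \<^const>\<open>onorm\<close> apply;
  the norm on a product type is the one of the orthogonal direct sum.\<close>

class complex_inner = real_inner +
  fixes scaleC :: "complex \<Rightarrow> 'a \<Rightarrow> 'a"  (infixr \<open>*\<^sub>C\<close> 75)
    and cinner :: "'a \<Rightarrow> 'a \<Rightarrow> complex"
  assumes scaleC_add_right: "a *\<^sub>C (x + y) = a *\<^sub>C x + a *\<^sub>C y"
    and scaleC_add_left: "(a + b) *\<^sub>C x = a *\<^sub>C x + b *\<^sub>C x"
    and scaleC_scaleC: "a *\<^sub>C (b *\<^sub>C x) = (a * b) *\<^sub>C x"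
    and scaleC_one: "1 *\<^sub>C x = x"
    and scaleR_scaleC: "r *\<^sub>R x = complex_of_real r *\<^sub>C x"
    and cinner_commute: "cinner x y = cnj (cinner y x)"
    and cinner_add_left: "cinner (x + y) z = cinner x z + cinner y z"
    and cinner_scaleC_left: "cinner (a *\<^sub>C x) y = a * cinner x y"
    and inner_eq_Re_cinner: "inner x y = Re (cinner x y)"

instantiation prod :: (complex_inner, complex_inner) complex_inner
begin

definition scaleC_prod_def: "a *\<^sub>C p = (a *\<^sub>C fst p, a *\<^sub>C snd p)"
definition cinner_prod_def: "cinner p q = cinner (fst p) (fst q) + cinner (snd p) (snd q)"

instance
proof
  fix x y :: "'a \<times> 'b"
  show "cinner x y = cnj (cinner y x)"
    unfolding cinner_prod_def complex_cnj_add
    by (metis cinner_commute)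
qed (auto simp: scaleC_prod_def cinner_prod_def scaleC_add_right scaleC_add_left scaleC_scaleC
      scaleC_one scaleR_scaleC cinner_add_left cinner_scaleC_left
      inner_prod_def inner_eq_Re_cinner scaleR_prod_def algebra_simps)

end

definition bounded_operator :: "('a::complex_inner \<Rightarrow> 'b::complex_inner) \<Rightarrow> bool" where
  "bounded_operator T \<longleftrightarrow> bounded_linear T \<and> (\<forall>c x. T (c *\<^sub>C x) = c *\<^sub>C T x)"

definition contraction :: "('a::complex_inner \<Rightarrow> 'a) \<Rightarrow> bool" where
  "contraction T \<longleftrightarrow> bounded_operator T \<and> onorm T \<le> 1"

definition similar_to_contraction :: "('a::complex_inner \<Rightarrow> 'a) \<Rightarrow> bool" where
  "similar_to_contraction T \<longleftrightarrow>
     (\<exists>W :: 'a \<Rightarrow> 'a. bounded_operator W \<and> bij W \<and> bounded_operator (inv W) \<and>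
        contraction (inv W \<circ> T \<circ> W))"

definition cadjoint :: "('a::complex_inner \<Rightarrow> 'b::complex_inner) \<Rightarrow> 'b \<Rightarrow> 'a" where
  "cadjoint T = (THE T'. \<forall>x y. cinner (T x) y = cinner x (T' y))"

definition orth_proj :: "'a::complex_inner set \<Rightarrow> 'a \<Rightarrow> 'a" where
  "orth_proj M x = (THE y. y \<in> M \<and> (\<forall>m\<in>M. cinner (x - y) m = 0))"

definition upper_triangular ::
    "('a::complex_inner \<Rightarrow> 'a) \<Rightarrow> ('b::complex_inner \<Rightarrow> 'a) \<Rightarrow> ('b \<Rightarrow> 'b) \<Rightarrow> 'a \<times> 'b \<Rightarrow> 'a \<times> 'b" where
  "upper_triangular A X B = (\<lambda>(x, y). (A x + X y, B y))"


section \<open>The space \<open>L\<^sup>2\<close> of the unit circle\<close>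

text \<open>Normalized arc length.  The underlying space is the circle itself, so measurability of
  a function on the complex plane concerns only its values on the circle.\<close>

definition circle_measure :: "complex measure" where
  "circle_measure =
     distr (uniform_measure lborel {0..<2 * pi}) (restrict_space borel (sphere 0 1)) cis"

lemma measurable_cis [measurable]: "cis \<in> borel \<rightarrow>\<^sub>M restrict_space borel (sphere 0 1)"
  by (intro measurable_restrict_space2 borel_measurable_continuous_onI)
     (auto intro!: continuous_intros)

lemma measurable_cis' [measurable]:
  "cis \<in> uniform_measure lborel A \<rightarrow>\<^sub>M restrict_space borel (sphere 0 1)"
  using measurable_cis
  by (simp only: measurable_cong_sets[OF sets_uniform_measure refl]
      measurable_cong_sets[OF sets_lborel refl])

lemma space_circle_measure [simp]: "space circle_measure = sphere 0 1"
  by (simp add: circle_measure_def space_restrict_space)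

lemma sets_circle_measure [simp, measurable_cong]:
  "sets circle_measure = sets (restrict_space borel (sphere 0 1))"
  by (simp add: circle_measure_def)

lemma emeasure_circle_measure_space: "emeasure circle_measure (sphere 0 1) = 1"
proof -
  have "sphere 0 1 \<in> sets (restrict_space borel (sphere (0::complex) 1))"
    by (metis sets.top space_circle_measure sets_circle_measure)
  then show ?thesis
    unfolding circle_measure_def
    by (subst emeasure_distr)
       (auto simp: vimage_def intro!: emeasure_uniform_measure_1 simp flip: ennreal_0)
qed

interpretation circle: finite_measure circle_measure
  by standard (simp add: emeasure_circle_measure_space)

lemma circle_measurableI:
  "continuous_on (sphere 0 1) f \<Longrightarrow> f \<in> borel_measurable circle_measure"
  using borel_measurable_continuous_on_restrict[of "sphere 0 1" f]
  by (simp only: measurable_cong_sets[OF sets_circle_measure refl])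

lemma measurable_cnj [measurable]: "cnj \<in> borel \<rightarrow>\<^sub>M borel"
  by (intro borel_measurable_continuous_onI continuous_intros)

definition square_integrable :: "(complex \<Rightarrow> complex) set" where
  "square_integrable = {f. f \<in> borel_measurable circle_measure \<and>
     integrable circle_measure (\<lambda>z. (cmod (f z))\<^sup>2)}"

definition L_infinity :: "(complex \<Rightarrow> complex) set" where
  "L_infinity = {\<phi>. \<phi> \<in> borel_measurable circle_measure \<and>
     (\<exists>C. AE z in circle_measure. cmod (\<phi> z) \<le> C)}"

lemma square_integrable_measurable: "f \<in> square_integrable \<Longrightarrow> f \<in> borel_measurable circle_measure"
  by (simp add: square_integrable_def)

lemma square_integrable_dominated:
  assumes "f \<in> borel_measurable circle_measure"
    and "integrable circle_measure g" "AE z in circle_measure. (cmod (f z))\<^sup>2 \<le> g z"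
  shows "f \<in> square_integrable"
proof -
  have "integrable circle_measure (\<lambda>z. (cmod (f z))\<^sup>2)"
    by (rule Bochner_Integration.integrable_bound[OF assms(2)]) (use assms in auto)
  then show ?thesis using assms by (simp add: square_integrable_def)
qed

lemma square_integrable_add:
  assumes "f \<in> square_integrable" "g \<in> square_integrable"
  shows "(\<lambda>z. f z + g z) \<in> square_integrable"
proof (rule square_integrable_dominated)
  show "integrable circle_measure (\<lambda>z. 2 * (cmod (f z))\<^sup>2 + 2 * (cmod (g z))\<^sup>2)"
    using assms by (simp add: square_integrable_def)
  have "(cmod (a + b))\<^sup>2 \<le> 2 * (cmod a)\<^sup>2 + 2 * (cmod b)\<^sup>2" for a b
  proof -
    have "(cmod (a + b))\<^sup>2 \<le> (cmod a + cmod b)\<^sup>2"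
      by (intro power_mono norm_triangle_ineq) auto
    also have "\<dots> \<le> 2 * (cmod a)\<^sup>2 + 2 * (cmod b)\<^sup>2"
      using sum_squares_bound[of "cmod a" "cmod b"] by (simp add: power2_sum)
    finally show ?thesis .
  qed
  then show "AE z in circle_measure. (cmod (f z + g z))\<^sup>2 \<le> 2 * (cmod (f z))\<^sup>2 + 2 * (cmod (g z))\<^sup>2"
    by simp
qed (use assms in \<open>auto intro!: borel_measurable_add dest: square_integrable_measurable\<close>)

lemma square_integrable_mult:
  assumes "\<phi> \<in> L_infinity" "f \<in> square_integrable"
  shows "(\<lambda>z. \<phi> z * f z) \<in> square_integrable"
proof -
  obtain C where C: "AE z in circle_measure. cmod (\<phi> z) \<le> C"
    using assms by (auto simp: L_infinity_def)
  show ?thesis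
  proof (rule square_integrable_dominated)
    show "integrable circle_measure (\<lambda>z. C\<^sup>2 * (cmod (f z))\<^sup>2)"
      using assms by (simp add: square_integrable_def)
    show "AE z in circle_measure. (cmod (\<phi> z * f z))\<^sup>2 \<le> C\<^sup>2 * (cmod (f z))\<^sup>2"
      using C by eventually_elim
        (auto simp: norm_mult power_mult_distrib intro!: mult_right_mono power_mono)
  qed (use assms in \<open>auto simp: L_infinity_def square_integrable_def\<close>)
qed

lemma L_infinity_continuous:
  assumes "continuous_on (sphere 0 1) f" shows "f \<in> L_infinity"
proof -
  have "bounded (f ` sphere 0 1)"
    using assms by (intro compact_imp_bounded compact_continuous_image) auto
  then obtain C where "\<And>z. z \<in> sphere 0 1 \<Longrightarrow> cmod (f z) \<le> C"
    by (metis bounded_iff imageI)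
  then have "AE z in circle_measure. cmod (f z) \<le> C"
    by (intro AE_I2) auto
  then show ?thesis
    using circle_measurableI[OF assms] by (auto simp: L_infinity_def)
qed

lemma square_integrable_one: "(\<lambda>z. 1) \<in> square_integrable"
  by (simp add: square_integrable_def)

lemma square_integrable_continuous:
  "continuous_on (sphere 0 1) f \<Longrightarrow> f \<in> square_integrable"
  using square_integrable_mult[OF L_infinity_continuous square_integrable_one] by simp

lemma square_integrable_cmult: "f \<in> square_integrable \<Longrightarrow> (\<lambda>z. c * f z) \<in> square_integrable"
  by (rule square_integrable_mult) (auto intro: L_infinity_continuous)

lemma integrable_mult_cnj:
  assumes "f \<in> square_integrable" "g \<in> square_integrable"
  shows "integrable circle_measure (\<lambda>z. f z * cnj (g z))"
proof (rule Bochner_Integration.integrable_bound)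
  show "integrable circle_measure (\<lambda>z. (cmod (f z))\<^sup>2 + (cmod (g z))\<^sup>2)"
    using assms by (simp add: square_integrable_def)
  have "cmod (a * cnj b) \<le> (cmod a)\<^sup>2 + (cmod b)\<^sup>2" for a b
  proof -
    have "0 \<le> cmod a * cmod b" by simp
    moreover have "2 * (cmod a * cmod b) \<le> (cmod a)\<^sup>2 + (cmod b)\<^sup>2"
      using sum_squares_bound[of "cmod a" "cmod b"] by (simp add: mult.assoc)
    ultimately show ?thesis
      unfolding norm_mult complex_mod_cnj by linarith
  qed
  then show "AE z in circle_measure. norm (f z * cnj (g z)) \<le> norm ((cmod (f z))\<^sup>2 + (cmod (g z))\<^sup>2)"
    by simp
  show "(\<lambda>z. f z * cnj (g z)) \<in> borel_measurable circle_measure"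
    using assms[THEN square_integrable_measurable] by measurable
qed

definition l2rel :: "(complex \<Rightarrow> complex) \<Rightarrow> (complex \<Rightarrow> complex) \<Rightarrow> bool" where
  "l2rel f g \<longleftrightarrow> f \<in> square_integrable \<and> g \<in> square_integrable \<and>
     (AE z in circle_measure. f z = g z)"

lemma part_equivp_l2rel: "part_equivp l2rel"
proof (rule part_equivpI)
  show "\<exists>f. l2rel f f" using square_integrable_one by (auto simp: l2rel_def)
  show "symp l2rel" by (auto simp: symp_def l2rel_def eq_commute)
  show "transp l2rel"
  proof (rule transpI)
    fix f g h assume *: "l2rel f g" "l2rel g h"
    then have "AE z in circle_measure. f z = g z" "AE z in circle_measure. g z = h z"
      by (auto simp: l2rel_def)
    then have "AE z in circle_measure. f z = h z" by eventually_elim simp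
    with * show "l2rel f h" by (simp add: l2rel_def)
  qed
qed

quotient_type L2 = "complex \<Rightarrow> complex" / partial: l2rel
  by (rule part_equivp_l2rel)

lemma l2rel_cinner_cong:
  assumes "l2rel f f'" "l2rel g g'"
  shows "(\<integral>z. f z * cnj (g z) \<partial>circle_measure) = (\<integral>z. f' z * cnj (g' z) \<partial>circle_measure)"
proof (rule integral_cong_AE)
  have m: "f \<in> borel_measurable circle_measure" "f' \<in> borel_measurable circle_measure"
    "g \<in> borel_measurable circle_measure" "g' \<in> borel_measurable circle_measure"
    using assms by (auto simp: l2rel_def square_integrable_measurable)
  show "(\<lambda>z. f z * cnj (g z)) \<in> borel_measurable circle_measure"
    using m by measurable
  show "(\<lambda>z. f' z * cnj (g' z)) \<in> borel_measurable circle_measure"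
    using m by measurable
  show "AE z in circle_measure. f z * cnj (g z) = f' z * cnj (g' z)"
    using assms unfolding l2rel_def by auto
qed

lemma Re_cinner_self:
  assumes "f \<in> square_integrable"
  shows "(\<integral>z. f z * cnj (f z) \<partial>circle_measure)
       = complex_of_real (\<integral>z. (cmod (f z))\<^sup>2 \<partial>circle_measure)"
proof -
  have "f z * cnj (f z) = complex_of_real ((cmod (f z))\<^sup>2)" for z
    by (metis complex_norm_square of_real_power)
  then show ?thesis by (simp only: integral_complex_of_real)
qed

instantiation L2 :: complex_inner
begin

lift_definition zero_L2 :: L2 is "\<lambda>_. 0"
  by (simp add: l2rel_def square_integrable_def)

lift_definition plus_L2 :: "L2 \<Rightarrow> L2 \<Rightarrow> L2" is "\<lambda>f g z. f z + g z"
  by (auto simp: l2rel_def square_integrable_add)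

lift_definition scaleC_L2 :: "complex \<Rightarrow> L2 \<Rightarrow> L2" is "\<lambda>c f z. c * f z"
  by (auto simp: l2rel_def square_integrable_cmult)

lift_definition cinner_L2 :: "L2 \<Rightarrow> L2 \<Rightarrow> complex"
  is "\<lambda>f g. \<integral>z. f z * cnj (g z) \<partial>circle_measure"
  by (rule l2rel_cinner_cong)

definition uminus_L2 :: "L2 \<Rightarrow> L2" where "uminus_L2 f = (-1) *\<^sub>C f"
definition minus_L2 :: "L2 \<Rightarrow> L2 \<Rightarrow> L2" where "minus_L2 f g = f + - g"
definition scaleR_L2 :: "real \<Rightarrow> L2 \<Rightarrow> L2" where "scaleR_L2 r f = complex_of_real r *\<^sub>C f"
definition inner_L2 :: "L2 \<Rightarrow> L2 \<Rightarrow> real" where "inner_L2 f g = Re (cinner f g)"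
definition norm_L2 :: "L2 \<Rightarrow> real" where "norm_L2 f = sqrt (inner f f)"
definition dist_L2 :: "L2 \<Rightarrow> L2 \<Rightarrow> real" where "dist_L2 f g = norm (f - g)"
definition sgn_L2 :: "L2 \<Rightarrow> L2" where "sgn_L2 f = inverse (norm f) *\<^sub>R f"
definition uniformity_L2 :: "(L2 \<times> L2) filter" where
  "uniformity_L2 = (INF e\<in>{0<..}. principal {(x, y). dist x y < e})"
definition open_L2 :: "L2 set \<Rightarrow> bool" where
  "open_L2 U \<longleftrightarrow> (\<forall>x\<in>U. eventually (\<lambda>(x', y). x' = x \<longrightarrow> y \<in> U) uniformity)"

instance
proof
  fix x y z :: L2 and a b :: complex and r s :: real
  show add_assoc: "x + y + z = x + (y + z)"
    by transfer (auto simp: l2rel_def square_integrable_add algebra_simps)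
  show add_comm: "x + y = y + x"
    by transfer (auto simp: l2rel_def square_integrable_add algebra_simps)
  show "0 + x = x"
    by transfer (auto simp: l2rel_def)
  show "- x + x = 0"
    unfolding uminus_L2_def
    by transfer (auto simp: l2rel_def square_integrable_def)
  show "x - y = x + - y" by (rule minus_L2_def)
  show scC1: "a *\<^sub>C (x + y) = a *\<^sub>C x + a *\<^sub>C y" for a and x y :: L2
    by transfer (auto simp: l2rel_def square_integrable_add square_integrable_cmult algebra_simps)
  show scC2: "(a + b) *\<^sub>C x = a *\<^sub>C x + b *\<^sub>C x" for a b and x :: L2
    by transfer (auto simp: l2rel_def distrib_right square_integrable_add square_integrable_cmult)
  show scC3: "a *\<^sub>C (b *\<^sub>C x) = (a * b) *\<^sub>C x" for a b and x :: L2
    by transfer (auto simp: l2rel_def mult.assoc square_integrable_cmult)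
  show scC4: "1 *\<^sub>C x = x" for x :: L2
    by transfer (auto simp: l2rel_def)
  show "r *\<^sub>R x = complex_of_real r *\<^sub>C x" by (rule scaleR_L2_def)
  show "r *\<^sub>R (x + y) = r *\<^sub>R x + r *\<^sub>R y" by (simp add: scaleR_L2_def scC1)
  show "(r + s) *\<^sub>R x = r *\<^sub>R x + s *\<^sub>R x" by (simp add: scaleR_L2_def scC2)
  show "r *\<^sub>R (s *\<^sub>R x) = (r * s) *\<^sub>R x" by (simp add: scaleR_L2_def scC3)
  show "1 *\<^sub>R x = x" by (simp add: scaleR_L2_def scC4)
  show comm: "cinner x y = cnj (cinner y x)" for x y :: L2
    by transfer (simp add: mult.commute flip: Bochner_Integration.integral_cnj)
  show addl: "cinner (x + y) z = cinner x z + cinner y z"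
    by transfer (auto simp: l2rel_def distrib_right integrable_mult_cnj
        intro!: Bochner_Integration.integral_add)
  show scl: "cinner (a *\<^sub>C x) y = a * cinner x y" for a and x y :: L2
    by transfer (simp add: mult.assoc)
  show "inner x y = Re (cinner x y)" by (rule inner_L2_def)
  show "inner x y = inner y x"
    unfolding inner_L2_def by (subst comm) simp
  show "inner (x + y) z = inner x z + inner y z"
    by (simp add: inner_L2_def addl)
  show "inner (r *\<^sub>R x) y = r * inner x y"
    by (simp add: inner_L2_def scaleR_L2_def scl)
  show "0 \<le> inner x x"
    unfolding inner_L2_def by transfer (simp add: l2rel_def Re_cinner_self)
  show "(inner x x = 0) = (x = 0)"
    unfolding inner_L2_def
  proof transfer
    fix f assume "l2rel f f"
    then have f: "f \<in> square_integrable" by (simp add: l2rel_def)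
    have "(Re (\<integral>z. f z * cnj (f z) \<partial>circle_measure) = 0) \<longleftrightarrow>
          (AE z in circle_measure. (cmod (f z))\<^sup>2 = 0)"
      using f by (simp add: Re_cinner_self square_integrable_def integral_nonneg_eq_0_iff_AE)
    also have "\<dots> \<longleftrightarrow> l2rel f (\<lambda>_. 0)"
      using f by (auto simp: l2rel_def square_integrable_def)
    finally show "(Re (\<integral>z. f z * cnj (f z) \<partial>circle_measure) = 0) = l2rel f (\<lambda>_. 0)" .
  qed
  show "norm x = sqrt (inner x x)" by (rule norm_L2_def)
  show "dist x y = norm (x - y)" by (rule dist_L2_def)
  show "sgn x = inverse (norm x) *\<^sub>R x" by (rule sgn_L2_def)
  show "uniformity = (INF e\<in>{0<..}. principal {(x, y). dist (x::L2) y < e})"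
    by (rule uniformity_L2_def)
  show "open U \<longleftrightarrow> (\<forall>x\<in>U. \<forall>\<^sub>F (x', y) in uniformity. x' = x \<longrightarrow> y \<in> U)" for U :: "L2 set"
    by (rule open_L2_def)
qed

end


text \<open>The class of a square integrable function; zero if the function is not square integrable.\<close>

lift_definition L2_of :: "(complex \<Rightarrow> complex) \<Rightarrow> L2"
  is "\<lambda>f. if f \<in> square_integrable then f else (\<lambda>_. 0)"
  by (auto simp: l2rel_def square_integrable_def)

text \<open>Multiplication by \<open>\<phi> \<in> L\<^sup>\<infinity>\<close>; zero if \<open>\<phi>\<close> is not essentially bounded.\<close>

lift_definition mult_L2 :: "(complex \<Rightarrow> complex) \<Rightarrow> L2 \<Rightarrow> L2"
  is "\<lambda>\<phi> f. if \<phi> \<in> L_infinity then (\<lambda>z. \<phi> z * f z) else (\<lambda>_. 0)"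
  by (auto simp: l2rel_def square_integrable_mult) (simp_all add: square_integrable_def)

lemma measurable_cnj_circle [measurable]: "cnj \<in> circle_measure \<rightarrow>\<^sub>M circle_measure"
proof -
  have "cnj \<in> restrict_space borel (sphere 0 1) \<rightarrow>\<^sub>M restrict_space borel (sphere 0 1)"
    by (intro measurable_restrict_space3 measurable_cnj) auto
  then show ?thesis
    by (simp only: measurable_cong_sets[OF sets_circle_measure sets_circle_measure])
qed

lemma emeasure_circle_measure:
  assumes "A \<in> sets circle_measure"
  shows "emeasure circle_measure A =
    emeasure lborel ({0..<2 * pi} \<inter> cis -` A) / ennreal (2 * pi)"
proof -
  have A: "A \<in> sets (restrict_space borel (sphere 0 1))"
    using assms by simp
  have "cis -` A \<inter> space borel \<in> sets borel"
    by (rule measurable_sets[OF measurable_cis A])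
  then have B: "cis -` A \<in> sets borel" by simp
  show ?thesis
    unfolding circle_measure_def
    by (subst emeasure_distr[OF measurable_cis' A]) (simp add: B emeasure_uniform_measure)
qed

lemma distr_circle_measure_cnj: "distr circle_measure circle_measure cnj = circle_measure"
proof (rule measure_eqI)
  fix A assume "A \<in> sets (distr circle_measure circle_measure cnj)"
  then have A: "A \<in> sets circle_measure" by simp
  define A' where "A' = cnj -` A \<inter> space circle_measure"
  have A': "A' \<in> sets circle_measure"
    unfolding A'_def by (rule measurable_sets[OF measurable_cnj_circle A])
  have borel: "cis -` X \<in> sets borel" if "X \<in> sets circle_measure" for X
    using measurable_sets[OF measurable_cis] that by force
  have "emeasure lborel ({0..<2 * pi} \<inter> cis -` A')
      = emeasure (distr lborel borel (\<lambda>x. 2 * pi + (-1) * x)) ({0..<2 * pi} \<inter> cis -` A')"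
    using lborel_affine[of "-1" "2 * pi"] by (simp add: density_1)
  also have "\<dots> = emeasure lborel ((\<lambda>x. 2 * pi + (-1) * x) -` ({0..<2 * pi} \<inter> cis -` A') \<inter> space lborel)"
    using borel[OF A'] by (intro emeasure_distr) auto
  also have "(\<lambda>x. 2 * pi + (-1) * x) -` ({0..<2 * pi} \<inter> cis -` A') \<inter> space lborel
      = {0<..2 * pi} \<inter> cis -` A"
  proof -
    have "cnj (cis (2 * pi - x)) = cis x" for x
      by (simp add: complex_eq_iff)
    then show ?thesis
      by (auto simp: A'_def)
  qed
  also have "emeasure lborel ({0<..2 * pi} \<inter> cis -` A) = emeasure lborel ({0..<2 * pi} \<inter> cis -` A)"
  proof (rule emeasure_eq_AE)
    show "AE x in lborel. (x \<in> {0<..2 * pi} \<inter> cis -` A) = (x \<in> {0..<2 * pi} \<inter> cis -` A)"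
      using AE_lborel_singleton[of 0] AE_lborel_singleton[of "2 * pi"]
      by eventually_elim auto
  qed (use borel[OF A] in auto)
  finally show "emeasure (distr circle_measure circle_measure cnj) A = emeasure circle_measure A"
    using A A' by (simp add: emeasure_distr emeasure_circle_measure flip: A'_def
        del: sets_circle_measure space_circle_measure)
qed simp

text \<open>The operator \<open>J\<close>.\<close>

lift_definition reflect_L2 :: "L2 \<Rightarrow> L2" is "\<lambda>f z. f (cnj z)"
proof -
  fix f g assume fg: "l2rel f g"
  have sq: "(\<lambda>z. h (cnj z)) \<in> square_integrable" if "h \<in> square_integrable" for h
  proof -
    have "integrable (distr circle_measure circle_measure cnj) (\<lambda>z. (cmod (h z))\<^sup>2)"
      using that by (simp add: distr_circle_measure_cnj square_integrable_def)
    then have "integrable circle_measure (\<lambda>z. (cmod (h (cnj z)))\<^sup>2)"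
      by (rule integrable_distr[OF measurable_cnj_circle])
    moreover have "(\<lambda>z. h (cnj z)) \<in> borel_measurable circle_measure"
      by (rule measurable_compose[OF measurable_cnj_circle square_integrable_measurable[OF that]])
    ultimately show ?thesis
      by (simp add: square_integrable_def)
  qed
  have "AE z in distr circle_measure circle_measure cnj. f z = g z"
    using fg unfolding distr_circle_measure_cnj l2rel_def by blast
  then have "AE z in circle_measure. f (cnj z) = g (cnj z)"
    by (rule AE_distrD[OF measurable_cnj_circle])
  then show "l2rel (\<lambda>z. f (cnj z)) (\<lambda>z. g (cnj z))"
    using fg sq by (simp add: l2rel_def)
qed

lemma norm_L2_of:
  assumes "f \<in> square_integrable"
  shows "(norm (L2_of f))\<^sup>2 = (\<integral>z. (cmod (f z))\<^sup>2 \<partial>circle_measure)"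
proof -
  have "(norm (L2_of f))\<^sup>2 = Re (cinner (L2_of f) (L2_of f))"
    by (simp add: power2_norm_eq_inner inner_L2_def)
  also have "\<dots> = (\<integral>z. (cmod (f z))\<^sup>2 \<partial>circle_measure)"
    using assms by transfer (simp add: Re_cinner_self)
  finally show ?thesis .
qed

lemma L2_of_surj: "\<exists>f\<in>square_integrable. x = L2_of f"
  by transfer (auto simp: l2rel_def)

lemma L2_of_add:
  "f \<in> square_integrable \<Longrightarrow> g \<in> square_integrable \<Longrightarrow> L2_of (\<lambda>z. f z + g z) = L2_of f + L2_of g"
  by transfer (auto simp: l2rel_def square_integrable_add)

lemma L2_of_cmult: "f \<in> square_integrable \<Longrightarrow> L2_of (\<lambda>z. c * f z) = c *\<^sub>C L2_of f"
  by transfer (auto simp: l2rel_def square_integrable_cmult)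

lemma L2_of_mult:
  "\<phi> \<in> L_infinity \<Longrightarrow> f \<in> square_integrable \<Longrightarrow> L2_of (\<lambda>z. \<phi> z * f z) = mult_L2 \<phi> (L2_of f)"
  by transfer (auto simp: l2rel_def square_integrable_mult)

lemma norm_scaleC_L2: "norm (c *\<^sub>C x) = cmod c * norm (x :: L2)"
proof -
  have "cinner (c *\<^sub>C x) (c *\<^sub>C x) = c * cnj (c * cinner x x)"
    by (metis cinner_commute cinner_scaleC_left)
  also have "cnj (cinner x x) = cinner x x"
    by (metis cinner_commute)
  then have "c * cnj (c * cinner x x) = complex_of_real ((cmod c)\<^sup>2) * cinner x x"
    by (simp add: complex_norm_square mult.assoc del: of_real_power)
  finally have "inner (c *\<^sub>C x) (c *\<^sub>C x) = (cmod c)\<^sup>2 * inner x x"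
    by (simp add: inner_L2_def del: of_real_power)
  then show ?thesis
    by (simp add: norm_eq_sqrt_inner real_sqrt_mult)
qed

lemma bounded_operator_mult_L2: "bounded_operator (mult_L2 \<phi>)"
proof (cases "\<phi> \<in> L_infinity")
  case True
  then obtain C where C: "AE z in circle_measure. cmod (\<phi> z) \<le> C"
    and m: "\<phi> \<in> borel_measurable circle_measure"
    by (auto simp: L_infinity_def)
  have sc: "mult_L2 \<phi> (c *\<^sub>C x) = c *\<^sub>C mult_L2 \<phi> x" for c x
    using True by transfer (auto simp: l2rel_def square_integrable_mult square_integrable_cmult)
  have "bounded_linear (mult_L2 \<phi>)"
  proof (rule bounded_linear_intro)
    show "mult_L2 \<phi> (x + y) = mult_L2 \<phi> x + mult_L2 \<phi> y" for x y
      using True by transfer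
        (auto simp: l2rel_def square_integrable_mult square_integrable_add distrib_left)
    show "mult_L2 \<phi> (r *\<^sub>R x) = r *\<^sub>R mult_L2 \<phi> x" for r x
      by (simp add: scaleR_scaleC sc)
    show "norm (mult_L2 \<phi> x) \<le> norm x * \<bar>C\<bar>" for x
    proof -
      obtain f where f: "f \<in> square_integrable" "x = L2_of f"
        using L2_of_surj by blast
      have "(norm (mult_L2 \<phi> x))\<^sup>2 = (\<integral>z. (cmod (\<phi> z * f z))\<^sup>2 \<partial>circle_measure)"
        using f True by (simp add: norm_L2_of square_integrable_mult flip: L2_of_mult)
      also have "\<dots> \<le> (\<integral>z. C\<^sup>2 * (cmod (f z))\<^sup>2 \<partial>circle_measure)"
      proof (rule integral_mono_AE)
        show "AE z in circle_measure. (cmod (\<phi> z * f z))\<^sup>2 \<le> C\<^sup>2 * (cmod (f z))\<^sup>2"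
          using C by eventually_elim
            (auto simp: norm_mult power_mult_distrib intro!: mult_right_mono power_mono)
      qed (use f square_integrable_mult[OF True f(1)] in \<open>auto simp: square_integrable_def\<close>)
      also have "\<dots> = (norm x * \<bar>C\<bar>)\<^sup>2"
        using f by (simp add: norm_L2_of power_mult_distrib)
      finally show ?thesis
        by (rule power2_le_imp_le) simp
    qed
  qed
  with sc show ?thesis by (simp add: bounded_operator_def)
next
  case False
  then have "mult_L2 \<phi> x = 0" for x
    by transfer (auto simp: l2rel_def square_integrable_def)
  then have "mult_L2 \<phi> = (\<lambda>_. 0)" by (rule ext)
  moreover have "c *\<^sub>C (0::L2) = 0" for c
    by transfer (auto simp: l2rel_def square_integrable_def)
  ultimately show ?thesis
    by (simp add: bounded_operator_def)
qed


section \<open>The Hardy space \<open>H\<^sup>2\<close>\<close>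

text \<open>The Hardy functions on the open disc, and the subspace of \<open>L\<^sup>2\<close> formed by their boundary
  values \<open>lim\<^bsub>r\<rightarrow>1-\<^esub> F(r z)\<close>, the limit being taken in \<open>L\<^sup>2\<close>.\<close>

definition hardy_functions :: "(complex \<Rightarrow> complex) set" where
  "hardy_functions = {F. F holomorphic_on ball 0 1 \<and>
     (\<exists>C. \<forall>r\<in>{0..<1}. (\<integral>z. (cmod (F (complex_of_real r * z)))\<^sup>2 \<partial>circle_measure) \<le> C)}"

definition dilate :: "(complex \<Rightarrow> complex) \<Rightarrow> real \<Rightarrow> L2" where
  "dilate F r = L2_of (\<lambda>z. F (complex_of_real r * z))"

definition hardy_space :: "L2 set" where
  "hardy_space = {f. \<exists>F\<in>hardy_functions. (dilate F \<longlongrightarrow> f) (at_left 1)}"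

lemma square_integrable_dilate:
  assumes "F holomorphic_on ball 0 1" "0 \<le> r" "r < 1"
  shows "(\<lambda>z. F (complex_of_real r * z)) \<in> square_integrable"
proof (rule square_integrable_continuous)
  have "continuous_on (ball 0 1) F"
    using assms by (simp add: holomorphic_on_imp_continuous_on)
  then show "continuous_on (sphere 0 1) (\<lambda>z. F (complex_of_real r * z))"
    by (rule continuous_on_compose2) (use assms in \<open>auto intro!: continuous_intros simp: norm_mult\<close>)
qed

lemma hardy_functions_iff:
  "F \<in> hardy_functions \<longleftrightarrow>
     F holomorphic_on ball 0 1 \<and> (\<exists>C. \<forall>r\<in>{0..<1}. norm (dilate F r) \<le> C)"
proof (cases "F holomorphic_on ball 0 1")
  case True
  have eq: "(\<integral>z. (cmod (F (complex_of_real r * z)))\<^sup>2 \<partial>circle_measure) = (norm (dilate F r))\<^sup>2"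
    if "r \<in> {0..<1}" for r
    using that True by (simp add: dilate_def norm_L2_of square_integrable_dilate)
  show ?thesis
  proof
    assume "F \<in> hardy_functions"
    then obtain C where "\<forall>r\<in>{0..<1}.
        (\<integral>z. (cmod (F (complex_of_real r * z)))\<^sup>2 \<partial>circle_measure) \<le> C"
      by (auto simp: hardy_functions_def)
    then have "\<And>r. r \<in> {0..<1} \<Longrightarrow> norm (dilate F r) \<le> sqrt C"
      using eq by (metis real_le_rsqrt)
    with True show "F holomorphic_on ball 0 1 \<and> (\<exists>C. \<forall>r\<in>{0..<1}. norm (dilate F r) \<le> C)"
      by blast
  next
    assume "F holomorphic_on ball 0 1 \<and> (\<exists>C. \<forall>r\<in>{0..<1}. norm (dilate F r) \<le> C)"
    then obtain C where "\<And>r. r \<in> {0..<1} \<Longrightarrow> norm (dilate F r) \<le> C"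
      by blast
    then have "\<And>r. r \<in> {0..<1} \<Longrightarrow> (norm (dilate F r))\<^sup>2 \<le> C\<^sup>2"
      by (simp add: power_mono)
    with True eq show "F \<in> hardy_functions"
      unfolding hardy_functions_def mem_Collect_eq by metis
  qed
qed (auto simp: hardy_functions_def)

lemma hardy_spaceE:
  assumes "f \<in> hardy_space"
  obtains F C where "F holomorphic_on ball 0 1" "(dilate F \<longlongrightarrow> f) (at_left 1)"
    "\<And>r. r \<in> {0..<1} \<Longrightarrow> norm (dilate F r) \<le> C"
proof -
  obtain F where F: "F \<in> hardy_functions" "(dilate F \<longlongrightarrow> f) (at_left 1)"
    using assms unfolding hardy_space_def by blast
  then obtain C where "F holomorphic_on ball 0 1" "\<forall>r\<in>{0..<1}. norm (dilate F r) \<le> C"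
    unfolding hardy_functions_iff by blast
  with F(2) show ?thesis by (intro that) blast+
qed

lemma eventually_at_left_1: "\<forall>\<^sub>F r in at_left (1::real). r \<in> {0..<1}"
  by (rule eventually_at_leftI[of 0]) auto

lemma hardy_space_add:
  assumes "f \<in> hardy_space" "g \<in> hardy_space" shows "f + g \<in> hardy_space"
proof -
  obtain F C where F: "F holomorphic_on ball 0 1" "(dilate F \<longlongrightarrow> f) (at_left 1)"
    and C: "\<And>r. r \<in> {0..<1} \<Longrightarrow> norm (dilate F r) \<le> C"
    using hardy_spaceE[OF assms(1)] by metis
  obtain G D where G: "G holomorphic_on ball 0 1" "(dilate G \<longlongrightarrow> g) (at_left 1)"
    and D: "\<And>r. r \<in> {0..<1} \<Longrightarrow> norm (dilate G r) \<le> D"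
    using hardy_spaceE[OF assms(2)] by metis
  have eq: "dilate (\<lambda>z. F z + G z) r = dilate F r + dilate G r" if "r \<in> {0..<1}" for r
    unfolding dilate_def using that F G by (intro L2_of_add square_integrable_dilate) auto
  have "norm (dilate (\<lambda>z. F z + G z) r) \<le> C + D" if "r \<in> {0..<1}" for r
    unfolding eq[OF that] using C[OF that] D[OF that] by (rule norm_triangle_mono)
  then have "(\<lambda>z. F z + G z) \<in> hardy_functions"
    using holomorphic_on_add[OF F(1) G(1)] unfolding hardy_functions_iff by blast
  moreover have "(dilate (\<lambda>z. F z + G z) \<longlongrightarrow> f + g) (at_left 1)"
    using tendsto_add[OF F(2) G(2)]
    by (rule Lim_transform_eventually) (use eventually_at_left_1 eq in \<open>auto elim: eventually_mono\<close>)
  ultimately show ?thesis by (auto simp: hardy_space_def)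
qed

lemma hardy_space_mult:
  assumes "f \<in> hardy_space" "p holomorphic_on UNIV" "continuous_on UNIV q"
    and p: "\<And>r z. p (complex_of_real r * z) = complex_of_real (q r) * p z" and "q 1 = 1"
  shows "mult_L2 p f \<in> hardy_space"
proof -
  obtain F C where F: "F holomorphic_on ball 0 1" "(dilate F \<longlongrightarrow> f) (at_left 1)"
    and C: "\<And>r. r \<in> {0..<1} \<Longrightarrow> norm (dilate F r) \<le> C"
    using hardy_spaceE[OF assms(1)] by metis
  have pinf: "p \<in> L_infinity"
    using assms(2) by (intro L_infinity_continuous)
      (meson holomorphic_on_imp_continuous_on continuous_on_subset top_greatest)
  have bl: "bounded_linear (mult_L2 p)"
    using bounded_operator_mult_L2 by (simp add: bounded_operator_def)
  then obtain K where K: "\<And>x. norm (mult_L2 p x) \<le> norm x * K" "0 \<le> K"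
    by (metis bounded_linear.nonneg_bounded)
  have "bounded (q ` {0..1})"
    using assms(3) by (intro compact_imp_bounded compact_continuous_image)
      (auto intro: continuous_on_subset)
  then obtain M where M: "\<And>r. r \<in> {0..1} \<Longrightarrow> \<bar>q r\<bar> \<le> M"
    by (metis bounded_iff imageI real_norm_def)
  have eq: "dilate (\<lambda>z. p z * F z) r = q r *\<^sub>R mult_L2 p (dilate F r)" if r: "r \<in> {0..<1}" for r
  proof -
    have sq: "(\<lambda>z. F (complex_of_real r * z)) \<in> square_integrable"
      using F r by (intro square_integrable_dilate) auto
    have "dilate (\<lambda>z. p z * F z) r
        = L2_of (\<lambda>z. complex_of_real (q r) * (p z * F (complex_of_real r * z)))"
      by (simp add: dilate_def p mult.assoc)
    also have "\<dots> = complex_of_real (q r) *\<^sub>C mult_L2 p (dilate F r)"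
      unfolding dilate_def L2_of_mult[OF pinf sq, symmetric]
      by (intro L2_of_cmult square_integrable_mult pinf sq)
    finally show ?thesis by (simp add: scaleR_scaleC)
  qed
  have "norm (dilate (\<lambda>z. p z * F z) r) \<le> M * (C * K)" if r: "r \<in> {0..<1}" for r
  proof -
    have "norm (mult_L2 p (dilate F r)) \<le> C * K"
      using K(1)[of "dilate F r"] mult_right_mono[OF C[OF r] K(2)] by linarith
    then show ?thesis
      unfolding eq[OF r] norm_scaleR using M[of r] r by (intro mult_mono) auto
  qed
  moreover have "(\<lambda>z. p z * F z) holomorphic_on ball 0 1"
    using F(1) assms(2) by (intro holomorphic_on_mult) (auto elim: holomorphic_on_subset)
  ultimately have "(\<lambda>z. p z * F z) \<in> hardy_functions"
    unfolding hardy_functions_iff by blast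
  moreover have "(dilate (\<lambda>z. p z * F z) \<longlongrightarrow> mult_L2 p f) (at_left 1)"
  proof (rule Lim_transform_eventually)
    have "(q \<longlongrightarrow> 1) (at_left 1)"
      using assms(3,5) by (metis UNIV_I continuous_on_def filterlim_at_split filterlim_at_within_not_equal
          tendsto_within_subset top_greatest)
    then have "((\<lambda>r. q r *\<^sub>R mult_L2 p (dilate F r)) \<longlongrightarrow> 1 *\<^sub>R mult_L2 p f) (at_left 1)"
      by (intro tendsto_scaleR bounded_linear.tendsto[OF bl] F(2))
    then show "((\<lambda>r. q r *\<^sub>R mult_L2 p (dilate F r)) \<longlongrightarrow> mult_L2 p f) (at_left 1)"
      by simp
    show "\<forall>\<^sub>F r in at_left 1. q r *\<^sub>R mult_L2 p (dilate F r) = dilate (\<lambda>z. p z * F z) r"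
      using eventually_at_left_1 by eventually_elim (simp add: eq)
  qed
  ultimately show ?thesis by (auto simp: hardy_space_def)
qed

lemma hardy_space_one: "L2_of (\<lambda>_. 1) \<in> hardy_space"
proof -
  have "dilate (\<lambda>_. 1) = (\<lambda>_. L2_of (\<lambda>_. 1))"
    by (simp add: dilate_def fun_eq_iff)
  then have "(\<lambda>_. 1) \<in> hardy_functions \<and> (dilate (\<lambda>_. 1) \<longlongrightarrow> L2_of (\<lambda>_. 1)) (at_left 1)"
    by (auto simp: hardy_functions_iff)
  then show ?thesis unfolding hardy_space_def by blast
qed

lemma hardy_space_scaleC:
  assumes "f \<in> hardy_space" shows "c *\<^sub>C f \<in> hardy_space"
proof -
  have "mult_L2 (\<lambda>_. c) f \<in> hardy_space"
    by (rule hardy_space_mult[where q = "\<lambda>_. 1", OF assms]) auto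
  moreover obtain g where "g \<in> square_integrable" "f = L2_of g"
    using L2_of_surj by blast
  ultimately show ?thesis
    by (simp add: L_infinity_continuous flip: L2_of_mult L2_of_cmult)
qed

lemma hardy_space_monomial: "L2_of (\<lambda>z. z ^ n) \<in> hardy_space"
proof -
  have "mult_L2 (\<lambda>z. z ^ n) (L2_of (\<lambda>_. 1)) \<in> hardy_space"
    by (rule hardy_space_mult[where q = "\<lambda>r. r ^ n", OF hardy_space_one])
       (auto simp: power_mult_distrib intro!: holomorphic_intros continuous_intros)
  moreover have "(\<lambda>z. z ^ n) \<in> L_infinity"
    by (intro L_infinity_continuous continuous_intros)
  ultimately show ?thesis
    using L2_of_mult[OF _ square_integrable_one, of "\<lambda>z. z ^ n"] by simp
qed

lemma hardy_space_zero: "0 \<in> hardy_space"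
proof -
  have "0 *\<^sub>C f = 0" for f :: L2
    by transfer (auto simp: l2rel_def square_integrable_def)
  then show ?thesis using hardy_space_scaleC[OF hardy_space_one, of 0] by simp
qed

typedef H2 = hardy_space
  using hardy_space_zero by blast

setup_lifting type_definition_H2

instantiation H2 :: complex_inner
begin

lift_definition zero_H2 :: H2 is 0 by (rule hardy_space_zero)
lift_definition plus_H2 :: "H2 \<Rightarrow> H2 \<Rightarrow> H2" is "(+)" by (rule hardy_space_add)
lift_definition scaleC_H2 :: "complex \<Rightarrow> H2 \<Rightarrow> H2" is scaleC by (rule hardy_space_scaleC)
lift_definition cinner_H2 :: "H2 \<Rightarrow> H2 \<Rightarrow> complex" is cinner .
lift_definition uminus_H2 :: "H2 \<Rightarrow> H2" is uminus
  unfolding uminus_L2_def by (rule hardy_space_scaleC)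
lift_definition minus_H2 :: "H2 \<Rightarrow> H2 \<Rightarrow> H2" is minus
  unfolding minus_L2_def uminus_L2_def by (intro hardy_space_add hardy_space_scaleC)
lift_definition scaleR_H2 :: "real \<Rightarrow> H2 \<Rightarrow> H2" is scaleR
  unfolding scaleR_L2_def by (rule hardy_space_scaleC)
lift_definition inner_H2 :: "H2 \<Rightarrow> H2 \<Rightarrow> real" is inner .
lift_definition norm_H2 :: "H2 \<Rightarrow> real" is norm .
lift_definition dist_H2 :: "H2 \<Rightarrow> H2 \<Rightarrow> real" is dist .
lift_definition sgn_H2 :: "H2 \<Rightarrow> H2" is sgn
  unfolding sgn_L2_def scaleR_L2_def by (rule hardy_space_scaleC)
definition uniformity_H2 :: "(H2 \<times> H2) filter" where
  "uniformity_H2 = (INF e\<in>{0<..}. principal {(x, y). dist x y < e})"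
definition open_H2 :: "H2 set \<Rightarrow> bool" where
  "open_H2 U \<longleftrightarrow> (\<forall>x\<in>U. eventually (\<lambda>(x', y). x' = x \<longrightarrow> y \<in> U) uniformity)"

instance
proof
  fix x y z :: H2 and a b :: complex and r s :: real
  show "x + y + z = x + (y + z)" by transfer (simp add: add.assoc)
  show "x + y = y + x" by transfer (simp add: add.commute)
  show "0 + x = x" by transfer simp
  show "- x + x = 0" by transfer simp
  show "x - y = x + - y" by transfer simp
  show "r *\<^sub>R (x + y) = r *\<^sub>R x + r *\<^sub>R y" by transfer (simp add: scaleR_add_right)
  show "(r + s) *\<^sub>R x = r *\<^sub>R x + s *\<^sub>R x" by transfer (simp add: scaleR_add_left)
  show "r *\<^sub>R (s *\<^sub>R x) = (r * s) *\<^sub>R x" by transfer simp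
  show "1 *\<^sub>R x = x" by transfer simp
  show "a *\<^sub>C (x + y) = a *\<^sub>C x + a *\<^sub>C y" by transfer (rule scaleC_add_right)
  show "(a + b) *\<^sub>C x = a *\<^sub>C x + b *\<^sub>C x" by transfer (rule scaleC_add_left)
  show "a *\<^sub>C (b *\<^sub>C x) = (a * b) *\<^sub>C x" by transfer (rule scaleC_scaleC)
  show "1 *\<^sub>C x = x" by transfer (rule scaleC_one)
  show "r *\<^sub>R x = complex_of_real r *\<^sub>C x" by transfer (rule scaleR_scaleC)
  show "cinner x y = cnj (cinner y x)" by transfer (rule cinner_commute)
  show "cinner (x + y) z = cinner x z + cinner y z" by transfer (rule cinner_add_left)
  show "cinner (a *\<^sub>C x) y = a * cinner x y" by transfer (rule cinner_scaleC_left)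
  show "inner x y = Re (cinner x y)" by transfer (rule inner_eq_Re_cinner)
  show "inner x y = inner y x" by transfer (rule inner_commute)
  show "inner (x + y) z = inner x z + inner y z" by transfer (rule inner_add_left)
  show "inner (r *\<^sub>R x) y = r * inner x y" by transfer simp
  show "0 \<le> inner x x" by transfer simp
  show "(inner x x = 0) = (x = 0)" by transfer simp
  show "norm x = sqrt (inner x x)" by transfer (rule norm_eq_sqrt_inner)
  show "dist x y = norm (x - y)" by transfer (rule dist_norm)
  show "sgn x = inverse (norm x) *\<^sub>R x" by transfer (rule sgn_div_norm)
  show "uniformity = (INF e\<in>{0<..}. principal {(x, y). dist (x::H2) y < e})"
    by (rule uniformity_H2_def)
  show "open U \<longleftrightarrow> (\<forall>x\<in>U. \<forall>\<^sub>F (x', y) in uniformity. x' = x \<longrightarrow> y \<in> U)" for U :: "H2 set"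
    by (rule open_H2_def)
qed

end

lift_definition monomial :: "nat \<Rightarrow> H2" is "\<lambda>n. L2_of (\<lambda>z. z ^ n)"
  by (rule hardy_space_monomial)

text \<open>Under the boundary value identification, multiplication by \<open>z\<close> on the circle is the
  shift on the disc.\<close>

lift_definition shift :: "H2 \<Rightarrow> H2" is "mult_L2 (\<lambda>z. z)"
  by (rule hardy_space_mult[where q = "\<lambda>r. r"]) auto

definition hankel :: "(complex \<Rightarrow> complex) \<Rightarrow> H2 \<Rightarrow> H2" where
  "hankel \<phi> f = Abs_H2 (orth_proj hardy_space (mult_L2 \<phi> (reflect_L2 (Rep_H2 f))))"

end

theory Submission
  imports Defs
begin

text \<open>The operator \<open>T\<close> of the theorem is not power bounded.  The upper right entry of \<open>T\<^sup>n\<close> is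
  \<open>X\<^sub>n = (\<Sum>k<n. S\<^bsup>n-1-k\<^esup> H (S\<^sup>*)\<^sup>k)\<close>, and for \<open>v\<^sub>m = 1 + z + \<dots> + z\<^bsup>m-1\<^esup>\<close> the backward shift
  maps \<open>v\<^sub>m\<close> to \<open>v\<^bsub>m-1\<^esub>\<close>.  Hence \<open>\<langle>X\<^sub>n v\<^sub>n, v\<^sub>n\<rangle> = (\<Sum>k<n. \<langle>H v\<^bsub>n-k\<^esub>, v\<^bsub>k+1\<^esub>\<rangle>)\<close>.  All matrix entries
  occurring in the \<open>k\<close>-th term are at least \<open>1/(n+1)\<close>, so the sum is at least
  \<open>(\<Sum>k<n. (n-k)(k+1)/(n+1)) = n(n+2)/6\<close>, whereas power boundedness would bound it by
  \<open>K \<parallel>v\<^sub>n\<parallel>\<^sup>2 = K n\<close>.\<close>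

section \<open>Complex inner product spaces\<close>

lemma cinner_add_right: "cinner x (y + z) = cinner x y + cinner x z"
  by (metis cinner_add_left cinner_commute complex_cnj_add)

lemma cinner_scaleC_right: "cinner x (a *\<^sub>C y) = cnj a * cinner x y"
  by (metis cinner_commute cinner_scaleC_left complex_cnj_mult)

lemma cinner_zero_left [simp]: "cinner 0 y = 0"
  using cinner_add_left[of 0 0 y] by simp

lemma cinner_zero_right [simp]: "cinner x 0 = 0"
  using cinner_add_right[of x 0 0] by simp

lemma cinner_diff_left: "cinner (x - y) z = cinner x z - cinner y z"
  using cinner_add_left[of "x - y" y z] by (simp add: algebra_simps)

lemma cinner_diff_right: "cinner x (y - z) = cinner x y - cinner x z"
  using cinner_add_right[of x "y - z" z] by (simp add: algebra_simps)

lemma cinner_sum_left: "cinner (sum f A) y = (\<Sum>i\<in>A. cinner (f i) y)"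
  by (induction A rule: infinite_finite_induct) (simp_all add: cinner_add_left)

lemma cinner_sum_right: "cinner x (sum f A) = (\<Sum>i\<in>A. cinner x (f i))"
  by (induction A rule: infinite_finite_induct) (simp_all add: cinner_add_right)

lemma cinner_self: "cinner x x = complex_of_real ((norm x)\<^sup>2)"
proof -
  have "Im (cinner x x) = 0"
    using cinner_commute[of x x] by (simp add: complex_eq_iff)
  then show ?thesis
    by (simp add: complex_eq_iff power2_norm_eq_inner inner_eq_Re_cinner)
qed

lemma norm_scaleC: "norm (a *\<^sub>C x) = cmod a * norm x"
proof -
  have "complex_of_real ((norm (a *\<^sub>C x))\<^sup>2) = a * cnj a * complex_of_real ((norm x)\<^sup>2)"
    by (simp only: cinner_self[symmetric] cinner_scaleC_left cinner_scaleC_right mult_ac)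
  also have "\<dots> = complex_of_real ((cmod a * norm x)\<^sup>2)"
    by (simp only: complex_norm_square[symmetric] of_real_mult power_mult_distrib of_real_power)
  finally show ?thesis
    unfolding of_real_eq_iff by (simp add: power2_eq_iff_nonneg)
qed

lemma scaleC_zero_left [simp]: "0 *\<^sub>C x = 0"
  using scaleC_add_left[of 0 0 x] by simp

lemma scaleC_minus_one: "(-1) *\<^sub>C x = - x"
  using scaleR_scaleC[of "-1" x] by simp

lemma cmod_cinner_le: "cmod (cinner x y) \<le> norm x * norm y"
proof -
  \<comment> \<open>This factor of modulus at most 1 rotates the inner product onto the nonnegative
    real axis, which reduces the claim to the real Cauchy-Schwarz inequality.\<close>
  define c where "c = cnj (sgn (cinner x y))"
  have "c * cinner x y = complex_of_real (cmod (cinner x y))"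
    using complex_norm_square[of "cinner x y"]
    by (cases "cinner x y = 0") (simp_all add: c_def sgn_eq field_simps power2_eq_square)
  then have "cmod (cinner x y) = inner (c *\<^sub>C x) y"
    by (simp add: inner_eq_Re_cinner cinner_scaleC_left)
  also have "\<dots> \<le> norm (c *\<^sub>C x) * norm y"
    by (rule norm_cauchy_schwarz)
  also have "\<dots> \<le> norm x * norm y"
    unfolding norm_scaleC c_def
    by (intro mult_right_mono mult_left_le_one_le) (auto simp: norm_sgn)
  finally show ?thesis .
qed

lemma bounded_linear_cinner_left: "bounded_linear (\<lambda>x. cinner x y)"
  by (rule bounded_linear_intro[where K = "norm y"])
     (simp_all add: cinner_add_left cinner_scaleC_left scaleR_scaleC cmod_cinner_le scaleR_conv_of_real)

lemma cinner_right_cancel: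
  assumes "\<And>x. cinner x y = cinner x z" shows "y = z"
proof -
  have "cinner (y - z) (y - z) = 0"
    by (subst cinner_diff_right) (simp add: assms)
  then show ?thesis
    by (simp only: cinner_self) simp
qed

text \<open>\<open>cadjoint\<close> is a definite description, so evaluating it requires uniqueness,
  which nondegeneracy of the inner product supplies.\<close>

lemma cadjoint_eqI:
  assumes "\<And>x y. cinner (T x) y = cinner x (T' y)" shows "cadjoint T = T'"
  unfolding cadjoint_def
proof (rule the_equality)
  fix R assume "\<forall>x y. cinner (T x) y = cinner x (R y)"
  then show "R = T'" using assms by (intro ext cinner_right_cancel) metis
qed (use assms in blast)

text \<open>Two candidates differ by a vector of \<open>M\<close> that is orthogonal to itself,
  hence zero.\<close>

lemma orth_proj_eqI:
  assumes M: "\<And>x y. x \<in> M \<Longrightarrow> y \<in> M \<Longrightarrow> x - y \<in> M"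
    and "y \<in> M" "\<And>m. m \<in> M \<Longrightarrow> cinner (x - y) m = 0"
  shows "orth_proj M x = y"
  unfolding orth_proj_def
proof (rule the_equality)
  fix z assume z: "z \<in> M \<and> (\<forall>m\<in>M. cinner (x - z) m = 0)"
  then have "z - y \<in> M" using M assms by blast
  then have "cinner (x - y) (z - y) - cinner (x - z) (z - y) = 0"
    using z assms by simp
  then have "cinner (z - y) (z - y) = 0"
    by (simp flip: cinner_diff_left)
  then show "z = y" by (simp only: cinner_self) simp
qed (use assms in blast)

section \<open>Similarity to a contraction and power boundedness\<close>

text \<open>Conjugation commutes with powers, and powers of a contraction do not increase norms.
  Hence the product of a bound for \<open>W\<close> and a bound for \<open>inv W\<close> serves
  every power at once.\<close>

lemma power_bounded_if_similar_to_contraction: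
  fixes T :: "'a::complex_inner \<Rightarrow> 'a"
  assumes "similar_to_contraction T"
  obtains K where "\<And>n x. norm ((T ^^ n) x) \<le> K * norm x"
proof -
  obtain W :: "'a \<Rightarrow> 'a" where W: "bounded_operator W" "bij W" "bounded_operator (inv W)"
    and C: "contraction (inv W \<circ> T \<circ> W)"
    using assms unfolding similar_to_contraction_def by blast
  define C' where "C' = inv W \<circ> T \<circ> W"
  have C': "norm (C' x) \<le> norm x" for x
  proof -
    have "bounded_linear C'"
      using C unfolding contraction_def bounded_operator_def C'_def by blast
    then have "norm (C' x) \<le> onorm C' * norm x"
      by (rule onorm)
    also have "\<dots> \<le> 1 * norm x"
      using C by (intro mult_right_mono) (auto simp: contraction_def C'_def)
    finally show ?thesis by simp
  qed
  have pow: "norm ((C' ^^ n) x) \<le> norm x" for n x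
    by (induction n) (auto intro: order_trans[OF C'])
  have T: "(T ^^ n) x = W ((C' ^^ n) (inv W x))" for n x
    by (induction n) (use W(2) in \<open>simp_all add: C'_def bij_is_surj surj_f_inv_f\<close>)
  obtain K1 where K1: "\<And>x. norm (W x) \<le> norm x * K1" "0 \<le> K1"
    using W(1) by (metis bounded_operator_def bounded_linear.nonneg_bounded)
  obtain K2 where K2: "\<And>x. norm (inv W x) \<le> norm x * K2" "0 \<le> K2"
    using W(3) by (metis bounded_operator_def bounded_linear.nonneg_bounded)
  have "norm ((T ^^ n) x) \<le> (K1 * K2) * norm x" for n x
  proof -
    have "norm ((T ^^ n) x) \<le> norm ((C' ^^ n) (inv W x)) * K1"
      unfolding T by (rule K1)
    also have "\<dots> \<le> (norm x * K2) * K1"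
      by (intro mult_right_mono order_trans[OF pow] K2 K1)
    finally show ?thesis by (simp add: mult_ac)
  qed
  then show ?thesis by (rule that)
qed

section \<open>Completeness of \<open>L\<^sup>2\<close>\<close>

lemma nn_integral_L2_of:
  assumes "f \<in> square_integrable"
  shows "(\<integral>\<^sup>+z. ennreal ((cmod (f z))\<^sup>2) \<partial>circle_measure) = ennreal ((norm (L2_of f))\<^sup>2)"
  using assms
  by (subst nn_integral_eq_integral) (auto simp: norm_L2_of square_integrable_def)

lemma square_integrableI:
  assumes "f \<in> borel_measurable circle_measure"
    "(\<integral>\<^sup>+z. ennreal ((cmod (f z))\<^sup>2) \<partial>circle_measure) < \<infinity>"
  shows "f \<in> square_integrable"
  using assms unfolding square_integrable_def
  by (auto intro!: integrableI_bounded)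

lemma L2_of_uminus: "f \<in> square_integrable \<Longrightarrow> L2_of (\<lambda>z. - f z) = - L2_of f"
  using L2_of_cmult[of f "-1"] by (simp add: scaleC_minus_one)

lemma square_integrable_diff:
  assumes "f \<in> square_integrable" "g \<in> square_integrable"
  shows "(\<lambda>z. f z - g z) \<in> square_integrable"
  using square_integrable_add[OF assms(1) square_integrable_cmult[OF assms(2), of "-1"]] by simp

lemma L2_of_diff:
  assumes "f \<in> square_integrable" "g \<in> square_integrable"
  shows "L2_of (\<lambda>z. f z - g z) = L2_of f - L2_of g"
  using L2_of_add[OF assms(1) square_integrable_cmult[OF assms(2), of "-1"]]
  by (simp add: L2_of_uminus assms)

lemma cinner_L2_of:
  assumes "f \<in> square_integrable" "g \<in> square_integrable"
  shows "cinner (L2_of f) (L2_of g) = (\<integral>z. f z * cnj (g z) \<partial>circle_measure)"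
  using assms by transfer simp

text \<open>Cauchy-Schwarz for the pairing of the modulus of \<open>f\<close> with the constant 1,
  which has norm 1 because the measure is normalized.\<close>

lemma integral_cmod_le_norm_L2:
  assumes "f \<in> square_integrable"
  shows "integrable circle_measure f"
    and "(\<integral>z. cmod (f z) \<partial>circle_measure) \<le> norm (L2_of f)"
proof -
  show "integrable circle_measure f"
    using integrable_mult_cnj[OF assms square_integrable_one] by simp
  define g where "g z = complex_of_real (cmod (f z))" for z
  have g: "g \<in> square_integrable"
    using assms by (auto simp: square_integrable_def g_def[abs_def])
  have "norm (L2_of (\<lambda>_. 1)) = 1"
    using norm_L2_of[OF square_integrable_one]
    by (simp add: measure_def emeasure_circle_measure_space power2_eq_1_iff)
      (smt (verit) norm_ge_zero)
  moreover have "(norm (L2_of g))\<^sup>2 = (norm (L2_of f))\<^sup>2"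
    unfolding norm_L2_of[OF assms] norm_L2_of[OF g] by (simp add: g_def)
  then have "norm (L2_of g) = norm (L2_of f)"
    by (simp only: power2_eq_iff_nonneg norm_ge_zero)
  moreover have "cinner (L2_of g) (L2_of (\<lambda>_. 1)) = complex_of_real (\<integral>z. cmod (f z) \<partial>circle_measure)"
    by (simp add: cinner_L2_of g square_integrable_one g_def integral_complex_of_real)
  ultimately show "(\<integral>z. cmod (f z) \<partial>circle_measure) \<le> norm (L2_of f)"
    using cmod_cinner_le[of "L2_of g" "L2_of (\<lambda>_. 1)"] by simp
qed


text \<open>Fatou's lemma, applied to \<open>f m - f k\<close> as \<open>m\<close> grows, carries
  the Cauchy estimate over to \<open>g - f k\<close>. The lemma serves twice: for completeness, and
  to recognize a dilation as the limit of its Taylor polynomials.\<close>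

lemma L2_limit_of_AE_limit:
  fixes f :: "nat \<Rightarrow> complex \<Rightarrow> complex"
  assumes f: "\<And>k. f k \<in> square_integrable"
    and lim: "AE z in circle_measure. (\<lambda>k. f k z) \<longlonglongrightarrow> g z"
    and g: "g \<in> borel_measurable circle_measure"
    and cauchy: "Cauchy (\<lambda>k. L2_of (f k))"
  shows "(\<lambda>k. L2_of (f k)) \<longlonglongrightarrow> L2_of g"
proof -
  have [measurable]: "f k \<in> borel_measurable circle_measure" for k
    using f by (rule square_integrable_measurable)
  have bound: "(\<integral>\<^sup>+z. ennreal ((cmod (g z - f k z))\<^sup>2) \<partial>circle_measure) \<le> ennreal (e\<^sup>2)"
    if "\<And>m. m \<ge> k \<Longrightarrow> norm (L2_of (f m) - L2_of (f k)) \<le> e" for e k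
  proof -
    have "(\<integral>\<^sup>+z. ennreal ((cmod (g z - f k z))\<^sup>2) \<partial>circle_measure)
        = (\<integral>\<^sup>+z. liminf (\<lambda>m. ennreal ((cmod (f m z - f k z))\<^sup>2)) \<partial>circle_measure)"
    proof (rule nn_integral_cong_AE)
      show "AE z in circle_measure. ennreal ((cmod (g z - f k z))\<^sup>2)
          = liminf (\<lambda>m. ennreal ((cmod (f m z - f k z))\<^sup>2))"
        using lim
      proof eventually_elim
        case (elim z)
        have "(\<lambda>m. ennreal ((cmod (f m z - f k z))\<^sup>2)) \<longlonglongrightarrow> ennreal ((cmod (g z - f k z))\<^sup>2)"
          by (intro tendsto_ennrealI tendsto_intros elim)
        then show ?case
          by (intro lim_imp_Liminf[symmetric]) simp_all
      qed
    qed
    also have "\<dots> \<le> liminf (\<lambda>m. \<integral>\<^sup>+z. ennreal ((cmod (f m z - f k z))\<^sup>2) \<partial>circle_measure)"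
      by (intro nn_integral_liminf) measurable
    also have "\<dots> \<le> ennreal (e\<^sup>2)"
    proof (rule Liminf_le)
      show "\<forall>\<^sub>F m in sequentially.
          (\<integral>\<^sup>+z. ennreal ((cmod (f m z - f k z))\<^sup>2) \<partial>circle_measure) \<le> ennreal (e\<^sup>2)"
        using eventually_ge_at_top[of k]
      proof eventually_elim
        case (elim m)
        then show ?case
          using that[of m] f
          by (subst nn_integral_L2_of)
             (auto intro!: ennreal_leI power_mono square_integrable_diff simp: L2_of_diff)
      qed
    qed simp
    finally show ?thesis .
  qed
  have ev: "\<exists>K. \<forall>k\<ge>K. \<forall>m\<ge>k. norm (L2_of (f m) - L2_of (f k)) \<le> e" if "e > 0" for e
    using CauchyD[OF cauchy that] by (meson less_imp_le order_trans)
  \<comment> \<open>This has to come first, since \<open>L2_of\<close> sends a function that is not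
    square integrable to 0.\<close>
  have sq: "g \<in> square_integrable"
  proof -
    obtain k where "\<forall>m\<ge>k. norm (L2_of (f m) - L2_of (f k)) \<le> 1"
      using ev[of 1] by auto
    then have "(\<integral>\<^sup>+z. ennreal ((cmod (g z - f k z))\<^sup>2) \<partial>circle_measure) \<le> ennreal (1\<^sup>2)"
      by (intro bound) auto
    then have "(\<integral>\<^sup>+z. ennreal ((cmod (g z - f k z))\<^sup>2) \<partial>circle_measure) < \<infinity>"
      by (rule order.strict_trans1) simp
    then have "(\<lambda>z. g z - f k z) \<in> square_integrable"
      using f g by (intro square_integrableI) (auto dest!: square_integrable_measurable)
    from square_integrable_add[OF this f[of k]] show ?thesis by simp
  qed
  show ?thesis
  proof (rule LIMSEQ_I)
    fix e :: real assume "e > 0"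
    then obtain K where K: "\<forall>k\<ge>K. \<forall>m\<ge>k. norm (L2_of (f m) - L2_of (f k)) \<le> e / 2"
      using ev[of "e / 2"] by auto
    have "norm (L2_of (f k) - L2_of g) < e" if "k \<ge> K" for k
    proof -
      have "ennreal ((norm (L2_of g - L2_of (f k)))\<^sup>2) \<le> ennreal ((e / 2)\<^sup>2)"
        using bound[of k "e / 2"] K that
        by (simp only: nn_integral_L2_of[OF square_integrable_diff[OF sq f]] L2_of_diff[OF sq f])
      then have "norm (L2_of g - L2_of (f k)) \<le> e / 2"
        using \<open>e > 0\<close> by (auto simp: ennreal_le_iff intro: power2_le_imp_le)
      then show ?thesis using \<open>e > 0\<close> by (simp add: norm_minus_commute)
    qed
    then show "\<exists>K. \<forall>k\<ge>K. norm (L2_of (f k) - L2_of g) < e" by blast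
  qed
qed

text \<open>The increments are summable in \<open>L2\<close>, hence in \<open>L1\<close>, so the sum
  of their moduli has finite integral and is finite almost everywhere. The telescoping series then
  converges absolutely at almost every point.\<close>

lemma AE_convergent_of_summable_L2:
  assumes f: "\<And>k. f k \<in> square_integrable"
    and s: "summable (\<lambda>k. norm (L2_of (f (Suc k)) - L2_of (f k)))"
  shows "AE z in circle_measure. convergent (\<lambda>k. f k z)"
proof -
  define d where "d k z = f (Suc k) z - f k z" for k z
  have d: "d k \<in> square_integrable" for k
    unfolding d_def[abs_def] by (intro square_integrable_diff f)
  then have [measurable]: "d k \<in> borel_measurable circle_measure" for k
    by (rule square_integrable_measurable)
  have "(\<integral>\<^sup>+z. (\<Sum>k. ennreal (cmod (d k z))) \<partial>circle_measure)
      = (\<Sum>k. \<integral>\<^sup>+z. ennreal (cmod (d k z)) \<partial>circle_measure)"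
    by (intro nn_integral_suminf) measurable
  also have "\<dots> \<le> (\<Sum>k. ennreal (norm (L2_of (d k))))"
  proof (intro suminf_le)
    show "(\<integral>\<^sup>+z. ennreal (cmod (d k z)) \<partial>circle_measure) \<le> ennreal (norm (L2_of (d k)))" for k
      using integral_cmod_le_norm_L2[OF d[of k]]
      by (subst nn_integral_eq_integral) (auto intro: ennreal_leI)
  qed auto
  also have "\<dots> = ennreal (\<Sum>k. norm (L2_of (d k)))"
    using s f by (intro suminf_ennreal2) (simp_all add: d_def[abs_def] L2_of_diff)
  also have "\<dots> < \<infinity>" by simp
  finally have "AE z in circle_measure. (\<Sum>k. ennreal (cmod (d k z))) \<noteq> \<infinity>"
    by (intro nn_integral_PInf_AE) auto
  then show ?thesis
  proof eventually_elim
    case (elim z)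
    have "summable (\<lambda>k. cmod (d k z))"
      using elim by (intro summable_suminf_not_top) auto
    then have "summable (\<lambda>k. f (Suc k) z - f k z)"
      unfolding d_def by (rule summable_norm_cancel)
    then have "convergent (\<lambda>n. \<Sum>k<n. f (Suc k) z - f k z)"
      by (rule summable_iff_convergent[THEN iffD1])
    then have "convergent (\<lambda>n. f n z - f 0 z)"
      by (simp only: sum_lessThan_telescope[of "\<lambda>k. f k z"])
    then show ?case
      using convergent_add[OF _ convergent_const[of "f 0 z"]] by fastforce
  qed
qed

text \<open>Riesz-Fischer: a subsequence with geometrically decreasing steps converges almost
  everywhere, hence in \<open>L2\<close>, and a Cauchy sequence converges along with any
  subsequence. Completeness later provides the limits of power series in \<open>L2\<close>.\<close>

instance L2 :: complete_space
proof
  fix X :: "nat \<Rightarrow> L2" assume X: "Cauchy X"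
  have "\<exists>N. \<forall>m\<ge>N. \<forall>n\<ge>N. norm (X m - X n) < (1/2)^k" for k
    using CauchyD[OF X, of "(1/2)^k"] by simp
  then obtain N where N: "\<And>k m n. m \<ge> N k \<Longrightarrow> n \<ge> N k \<Longrightarrow> norm (X m - X n) < (1/2)^k"
    by metis
  \<comment> \<open>The sum dominates \<open>N k\<close>, and the summand \<open>k\<close> makes
    \<open>r\<close> strictly increasing.\<close>
  define r where "r k = k + (\<Sum>j\<le>k. N j)" for k
  have r: "strict_mono r"
    by (rule strict_monoI_Suc) (simp add: r_def)
  have rN: "r k \<ge> N k" for k
    using member_le_sum[of k "{..k}" N] by (simp add: r_def)
  have r_Suc: "r (Suc k) \<ge> N k" for k
    using rN[of k] r by (meson lessI order_trans less_imp_le strict_mono_less)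
  have "\<forall>k. \<exists>g. g \<in> square_integrable \<and> X (r k) = L2_of g"
    using L2_of_surj by blast
  then obtain f where f: "\<And>k. f k \<in> square_integrable" "\<And>k. X (r k) = L2_of (f k)"
    by metis
  have "summable (\<lambda>k. norm (L2_of (f (Suc k)) - L2_of (f k)))"
  proof (rule summable_comparison_test')
    show "summable (\<lambda>k. (1/2)^k :: real)" by (simp add: summable_geometric)
    show "norm (norm (L2_of (f (Suc k)) - L2_of (f k))) \<le> (1/2)^k" for k
      using N[OF r_Suc rN, of k] by (simp add: f)
  qed
  from AE_convergent_of_summable_L2[OF f(1) this]
  have "AE z in circle_measure. (\<lambda>k. f k z) \<longlonglongrightarrow> lim (\<lambda>k. f k z)"
    by (simp add: convergent_LIMSEQ_iff)
  moreover have "(\<lambda>z. lim (\<lambda>k. f k z)) \<in> borel_measurable circle_measure"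
    using f(1) by (intro borel_measurable_lim_metric square_integrable_measurable)
  moreover have "Cauchy (\<lambda>k. L2_of (f k))"
    using Cauchy_subseq_Cauchy[OF X r] by (simp add: f(2)[symmetric] o_def)
  ultimately have "(X \<circ> r) \<longlonglongrightarrow> L2_of (\<lambda>z. lim (\<lambda>k. f k z))"
    using L2_limit_of_AE_limit[OF f(1)] by (simp add: f(2) o_def)
  then show "convergent X"
    using Cauchy_converges_subseq[OF X r] by (auto simp: convergent_def)
qed


section \<open>Integrals over the circle\<close>

instance L2 :: banach ..

lemma borel_measurable_comp_cis:
  assumes "f \<in> borel_measurable circle_measure"
  shows "(\<lambda>t. f (cis t)) \<in> borel_measurable borel"
proof -
  have "f \<in> borel_measurable (restrict_space borel (sphere 0 1))"
    using assms by (simp only: measurable_cong_sets[OF sets_circle_measure refl])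
  then show ?thesis
    by (rule measurable_compose[OF measurable_cis])
qed

lemma integral_circle_measure:
  fixes f :: "complex \<Rightarrow> complex"
  assumes "f \<in> borel_measurable circle_measure"
  shows "(\<integral>z. f z \<partial>circle_measure)
    = (\<integral>t. indicator {0..<2 * pi} t *\<^sub>R f (cis t) \<partial>lborel) / (2 * pi)"
proof -
  have f: "f \<in> borel_measurable (restrict_space borel (sphere 0 1))"
    using assms by (simp only: measurable_cong_sets[OF sets_circle_measure refl])
  have "uniform_measure lborel {0..<2 * pi}
      = density lborel (\<lambda>t. ennreal (indicator {0..<2 * pi} t / (2 * pi)))"
    unfolding uniform_measure_def
    by (intro density_cong) (auto simp: divide_ennreal[symmetric] split: split_indicator)
  then have "(\<integral>z. f z \<partial>circle_measure)
      = (\<integral>t. f (cis t) \<partial>density lborel (\<lambda>t. ennreal (indicator {0..<2 * pi} t / (2 * pi))))"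
    unfolding circle_measure_def using integral_distr[OF measurable_cis' f] by metis
  also have "\<dots> = (\<integral>t. (indicator {0..<2 * pi} t / (2 * pi)) *\<^sub>R f (cis t) \<partial>lborel)"
    using borel_measurable_comp_cis[OF assms] by (intro integral_density) auto
  also have "\<dots> = (\<integral>t. (1 / (2 * pi)) *\<^sub>R (indicator {0..<2 * pi} t *\<^sub>R f (cis t)) \<partial>lborel)"
    by simp
  also have "\<dots> = (1 / (2 * pi)) *\<^sub>R (\<integral>t. indicator {0..<2 * pi} t *\<^sub>R f (cis t) \<partial>lborel)"
    by (rule integral_scaleR_right)
  finally show ?thesis by (simp add: scaleR_conv_of_real)
qed

text \<open>Agreement of \<open>f\<close> with \<open>g\<close> is asked only on the half-open
  interval, the endpoint \<open>2 * pi\<close> being a null set. This admits functions with a jump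
  at the point 1 of the circle, such as the symbol \<psi>.\<close>

lemma integral_circle_measure_FTC:
  fixes f :: "complex \<Rightarrow> complex"
  assumes f: "f \<in> borel_measurable circle_measure"
    and g: "\<And>t. t \<in> {0..<2 * pi} \<Longrightarrow> f (cis t) = g t" "continuous_on {0..2 * pi} g"
    and G: "\<And>t. (G has_vector_derivative g t) (at t)"
  shows "(\<integral>z. f z \<partial>circle_measure) = (G (2 * pi) - G 0) / (2 * pi)"
proof -
  have "(\<integral>t. indicator {0..<2 * pi} t *\<^sub>R f (cis t) \<partial>lborel)
      = (\<integral>t. indicator {0..2 * pi} t *\<^sub>R g t \<partial>lborel)"
  proof (rule integral_cong_AE)
    show "AE t in lborel. indicator {0..<2 * pi} t *\<^sub>R f (cis t) = indicator {0..2 * pi} t *\<^sub>R g t"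
      using AE_lborel_singleton[of "2 * pi"]
      by eventually_elim (auto simp: g(1) split: split_indicator)
    show "(\<lambda>t. indicator {0..<2 * pi} t *\<^sub>R f (cis t)) \<in> borel_measurable lborel"
      using borel_measurable_comp_cis[OF f] by simp
    show "(\<lambda>t. indicator {0..2 * pi} t *\<^sub>R g t) \<in> borel_measurable lborel"
      using borel_measurable_continuous_on_indicator[OF _ g(2)] by simp
  qed
  also have "\<dots> = G (2 * pi) - G 0"
    by (rule integral_FTC_Icc[OF _ has_vector_derivative_at_within[OF G] g(2)]) simp
  finally show ?thesis by (simp add: integral_circle_measure[OF f])
qed

lemma has_vector_derivative_cis:
  "((\<lambda>t. cis (c * t)) has_vector_derivative \<i> * complex_of_real c * cis (c * t)) (at t)"
proof -
  have "((\<lambda>z. exp (\<i> * of_real c * z)) has_field_derivative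
      \<i> * of_real c * exp (\<i> * of_real c * of_real t)) (at (of_real t))"
    by (auto intro!: derivative_eq_intros)
  from has_vector_derivative_real_field[OF this] show ?thesis
    by (simp add: cis_conv_exp mult.assoc)
qed

lemma integral_circle_measure_character:
  assumes "continuous_on (sphere 0 1) f" "\<And>t. f (cis t) = cis (of_int k * t)"
  shows "(\<integral>z. f z \<partial>circle_measure) = (if k = 0 then 1 else 0)"
proof (cases "k = 0")
  case True
  have "(\<integral>z. f z \<partial>circle_measure) = (complex_of_real (2 * pi) - complex_of_real 0) / (2 * pi)"
    using True assms
    by (intro integral_circle_measure_FTC[where g = "\<lambda>_. 1"] circle_measurableI)
       (auto intro!: has_vector_derivative_real_field[of "\<lambda>z. z"])
  then show ?thesis using True by simp
next
  case False
  define G where "G t = cis (real_of_int k * t) / (\<i> * of_int k)" for t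
  have "(\<integral>z. f z \<partial>circle_measure) = (G (2 * pi) - G 0) / (2 * pi)"
  proof (rule integral_circle_measure_FTC)
    show "(G has_vector_derivative cis (real_of_int k * t)) (at t)" for t
      using has_vector_derivative_divide[OF has_vector_derivative_cis[of "real_of_int k" t], of "\<i> * of_int k"] False
      by (simp add: G_def[abs_def])
  qed (use assms in \<open>auto intro!: circle_measurableI continuous_intros\<close>)
  moreover have "cis (real_of_int k * (2 * pi)) = 1"
    using cis_multiple_2pi[of "real_of_int k"] by (simp add: mult_ac)
  ultimately show ?thesis using False by (simp add: G_def)
qed


section \<open>Power series and the projection onto the Hardy space\<close>

text \<open>The monomials in the ambient space \<open>L2\<close>, kept apart from
  \<open>monomial\<close> in the subtype: Fourier series and the projection are treated before
  passing to \<open>H2\<close>.\<close>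

definition zpow :: "nat \<Rightarrow> L2" where
  "zpow n = L2_of (\<lambda>z. z ^ n)"

lemma square_integrable_power: "(\<lambda>z. z ^ n) \<in> square_integrable"
  by (intro square_integrable_continuous continuous_intros)

lemma cinner_zpow: "cinner (zpow m) (zpow n) = (if m = n then 1 else 0)"
proof -
  have "cis t ^ m * cnj (cis t ^ n) = cis (of_int (int m - int n) * t)" for t
  proof -
    have "cis t ^ m * cnj (cis t ^ n) = cis (real m * t + - (real n * t))"
      by (simp only: Complex.DeMoivre cis_cnj cis_mult)
    then show ?thesis by (simp add: algebra_simps)
  qed
  then have "(\<integral>z. z ^ m * cnj (z ^ n) \<partial>circle_measure) = (if int m - int n = 0 then 1 else 0)"
    by (intro integral_circle_measure_character continuous_intros)
  then show ?thesis
    by (simp add: zpow_def cinner_L2_of square_integrable_power)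
qed

lemma norm_zpow [simp]: "norm (zpow n) = 1"
  by (simp add: norm_eq_sqrt_inner inner_eq_Re_cinner cinner_zpow)

lemma norm_sum_zpow:
  assumes "finite A"
  shows "(norm (\<Sum>n\<in>A. c n *\<^sub>C zpow n))\<^sup>2 = (\<Sum>n\<in>A. (cmod (c n))\<^sup>2)"
proof -
  have "complex_of_real ((norm (\<Sum>n\<in>A. c n *\<^sub>C zpow n))\<^sup>2)
      = (\<Sum>n\<in>A. c n * cnj (c n))"
    unfolding cinner_self[symmetric] using assms
    by (simp add: cinner_sum_left cinner_sum_right cinner_scaleC_left cinner_scaleC_right
        cinner_zpow if_distrib mult.commute cong: if_cong)
  also have "\<dots> = complex_of_real (\<Sum>n\<in>A. (cmod (c n))\<^sup>2)"
    by (simp add: complex_norm_square del: of_real_power)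
  finally show ?thesis unfolding of_real_eq_iff .
qed

lemma L2_of_polynomial:
  "L2_of (\<lambda>z. \<Sum>n<N. c n * z ^ n) = (\<Sum>n<N. c n *\<^sub>C zpow n)"
proof (induction N)
  case 0
  have "L2_of (\<lambda>z. 0) = 0"
    using L2_of_cmult[OF square_integrable_one, of 0] by simp
  then show ?case by simp
next
  case (Suc N)
  have "(\<lambda>z. \<Sum>n<N. c n * z ^ n) \<in> square_integrable"
    by (intro square_integrable_continuous continuous_intros)
  then have "L2_of (\<lambda>z. (\<Sum>n<N. c n * z ^ n) + c N * z ^ N)
      = L2_of (\<lambda>z. \<Sum>n<N. c n * z ^ n) + L2_of (\<lambda>z. c N * z ^ N)"
    by (intro L2_of_add square_integrable_cmult square_integrable_power)
  also have "L2_of (\<lambda>z. c N * z ^ N) = c N *\<^sub>C zpow N"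
    unfolding zpow_def by (rule L2_of_cmult[OF square_integrable_power])
  finally show ?case using Suc.IH by simp
qed

text \<open>The series converges pointwise on the circle of radius \<open>r\<close>, and this
  pointwise limit identifies the limit in \<open>L2\<close>. The Cauchy hypothesis is met by
  absolute convergence in one application and by square summable coefficients in the other.\<close>

lemma dilate_power_series:
  assumes F: "\<And>z. z \<in> ball 0 1 \<Longrightarrow> (\<lambda>n. c n * z ^ n) sums F z"
    and r: "0 \<le> r" "r < 1"
    and cauchy: "Cauchy (\<lambda>N. \<Sum>n<N. (c n * of_real r ^ n) *\<^sub>C zpow n)"
  shows "(\<lambda>N. \<Sum>n<N. (c n * of_real r ^ n) *\<^sub>C zpow n) \<longlonglongrightarrow> dilate F r"
proof -
  define f where "f N z = (\<Sum>n<N. (c n * of_real r ^ n) * z ^ n)" for N and z :: complex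
  have f: "L2_of (f N) = (\<Sum>n<N. (c n * of_real r ^ n) *\<^sub>C zpow n)" for N
    unfolding f_def by (rule L2_of_polynomial)
  have "F holomorphic_on ball 0 1"
    using F by (intro power_series_holomorphic[of 0 1 c]) simp
  then have m: "(\<lambda>z. F (of_real r * z)) \<in> borel_measurable circle_measure"
    using r by (intro square_integrable_measurable square_integrable_dilate)
  have "(\<lambda>N. L2_of (f N)) \<longlonglongrightarrow> L2_of (\<lambda>z. F (of_real r * z))"
  proof (rule L2_limit_of_AE_limit[OF _ _ m])
    show "f N \<in> square_integrable" for N
      unfolding f_def by (intro square_integrable_continuous continuous_intros)
    show "AE z in circle_measure. (\<lambda>N. f N z) \<longlonglongrightarrow> F (of_real r * z)"
    proof (rule AE_I2)
      fix z assume "z \<in> space circle_measure"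
      then have "of_real r * z \<in> ball 0 1"
        using r by (simp add: norm_mult)
      from F[OF this] show "(\<lambda>N. f N z) \<longlonglongrightarrow> F (of_real r * z)"
        by (simp add: sums_def f_def power_mult_distrib mult.assoc)
    qed
  qed (use cauchy in \<open>simp add: f\<close>)
  then show ?thesis by (simp add: f dilate_def)
qed

text \<open>Each dilation is an \<open>L2\<close> limit of polynomials, and the boundary value is a
  limit of dilations; orthogonality to the monomials survives both limits. Here \<open>g\<close> may
  be any element of \<open>L2\<close>.\<close>

lemma cinner_hardy_space_eq_0:
  assumes g: "\<And>n. cinner (zpow n) g = 0" and f: "f \<in> hardy_space"
  shows "cinner f g = 0"
proof -
  obtain F where F: "F holomorphic_on ball 0 1" "(dilate F \<longlongrightarrow> f) (at_left 1)"
    using hardy_spaceE[OF f] by metis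
  define c where "c n = (deriv ^^ n) F 0 / fact n" for n
  have c: "(\<lambda>n. c n * z ^ n) sums F z" if "z \<in> ball 0 1" for z
    using holomorphic_power_series[OF F(1) that] by (simp add: c_def)
  have "cinner (dilate F r) g = 0" if r: "r \<in> {0..<1}" for r
  proof -
    \<comment> \<open>A radius strictly between \<open>r\<close> and 1: convergence of the series at
      \<open>s\<close> gives absolute convergence at \<open>r\<close>.\<close>
    define s where "s = (r + 1) / 2"
    have s: "r < s" "s < 1" "0 < s" using r by (auto simp: s_def)
    have "summable (\<lambda>n. c n * of_real s ^ n)"
      using c[of "of_real s"] s by (simp add: sums_iff)
    then have "summable (\<lambda>n. norm (c n * of_real r ^ n))"
      by (rule powser_insidea) (use s r in auto)
    then have "summable (\<lambda>n. norm ((c n * of_real r ^ n) *\<^sub>C zpow n))"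
      by (simp add: norm_scaleC)
    then have "summable (\<lambda>n. (c n * of_real r ^ n) *\<^sub>C zpow n)"
      by (rule summable_norm_cancel)
    then have "Cauchy (\<lambda>N. \<Sum>n<N. (c n * of_real r ^ n) *\<^sub>C zpow n)"
      by (simp add: summable_iff_convergent convergent_Cauchy)
    then have "(\<lambda>N. \<Sum>n<N. (c n * of_real r ^ n) *\<^sub>C zpow n) \<longlonglongrightarrow> dilate F r"
      using c r by (intro dilate_power_series) auto
    then have "(\<lambda>N. cinner (\<Sum>n<N. (c n * of_real r ^ n) *\<^sub>C zpow n) g) \<longlonglongrightarrow> cinner (dilate F r) g"
      by (rule bounded_linear.tendsto[OF bounded_linear_cinner_left])
    then show ?thesis
      by (simp add: cinner_sum_left cinner_scaleC_left g LIMSEQ_const_iff)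
  qed
  then have "\<forall>\<^sub>F r in at_left 1. cinner (dilate F r) g = 0"
    using eventually_at_left_1 by (auto elim: eventually_mono)
  then have "((\<lambda>r. cinner (dilate F r) g) \<longlongrightarrow> 0) (at_left 1)"
    by (rule tendsto_eventually)
  moreover have "((\<lambda>r. cinner (dilate F r) g) \<longlongrightarrow> cinner f g) (at_left 1)"
    by (rule bounded_linear.tendsto[OF bounded_linear_cinner_left F(2)])
  ultimately show ?thesis
    using tendsto_unique trivial_limit_at_left_real by metis
qed

text \<open>The partial sums of \<open>\<Sum>n. c\<^sub>n r\<^sup>n z\<^sup>n\<close> are Cauchy in \<open>L\<^sup>2\<close> uniformly for \<open>r\<close> in the closed interval
  \<open>[0, 1]\<close>; the dilations for \<open>r < 1\<close> and the boundary value at \<open>r = 1\<close> are therefore values of one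
  continuous function of \<open>r\<close>.\<close>

lemma hardy_space_of_square_summable:
  assumes c: "summable (\<lambda>n. (cmod (c n))\<^sup>2)"
  obtains p where "p \<in> hardy_space" "(\<lambda>N. \<Sum>n<N. c n *\<^sub>C zpow n) \<longlonglongrightarrow> p"
proof -
  define G where "G N r = (\<Sum>n<N. (c n * of_real r ^ n) *\<^sub>C zpow n)" for N and r :: real
  have "uniformly_Cauchy_on {0..1} G"
  proof (rule uniformly_Cauchy_onI')
    fix e :: real assume "e > 0"
    then have "e\<^sup>2 > 0" by simp
    with c obtain M where M: "\<And>m n. m \<ge> M \<Longrightarrow> norm (\<Sum>i=m..<n. (cmod (c i))\<^sup>2) < e\<^sup>2"
      unfolding summable_Cauchy by blast
    have "dist (G m r) (G n r) < e" if "r \<in> {0..1}" "m \<ge> M" "n > m" for r m n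
    proof -
      \<comment> \<open>By orthonormality the squared norm of this difference is a block of the
        coefficient series with factors \<open>r ^ i\<close>. The block at \<open>r = 1\<close>
        dominates it, which makes the estimate uniform in \<open>r\<close>.\<close>
      have "G n r - G m r = (\<Sum>i=m..<n. (c i * of_real r ^ i) *\<^sub>C zpow i)"
        unfolding G_def using that by (simp add: sum_diff_nat_ivl atLeast0LessThan[symmetric])
      then have "(norm (G n r - G m r))\<^sup>2 = (\<Sum>i=m..<n. (cmod (c i * of_real r ^ i))\<^sup>2)"
        by (simp add: norm_sum_zpow)
      also have "\<dots> \<le> (\<Sum>i=m..<n. (cmod (c i))\<^sup>2)"
      proof (intro sum_mono power_mono)
        show "cmod (c i * of_real r ^ i) \<le> cmod (c i)" for i
          using that by (simp add: norm_mult norm_power mult_left_le power_le_one)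
      qed simp
      also have "\<dots> < e\<^sup>2"
        using M[OF that(2), of n] by simp
      finally show ?thesis
        using \<open>e > 0\<close> by (simp add: dist_norm norm_minus_commute power2_less_imp_less)
    qed
    then show "\<exists>M. \<forall>r\<in>{0..1}. \<forall>m\<ge>M. \<forall>n>m. dist (G m r) (G n r) < e" by blast
  qed
  \<comment> \<open>Completeness of \<open>L2\<close> enters here.\<close>
  then obtain g where g: "uniform_limit {0..1} G g sequentially"
    using Cauchy_uniformly_convergent unfolding uniformly_convergent_on_def by blast
  then have lim: "(\<lambda>N. G N r) \<longlonglongrightarrow> g r" if "r \<in> {0..1}" for r
    using that by (rule tendsto_uniform_limitI)
  have cont: "continuous_on {0..1} g"
  proof (rule uniform_limit_theorem[OF _ g])
    have "continuous_on {0..1} (\<lambda>r. complex_of_real r ^ n * c n)" for n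
      by (intro continuous_intros)
    have "bounded_linear (\<lambda>z. z *\<^sub>C zpow n)" for n
      by (rule bounded_linear_intro[where K = "norm (zpow n)"])
         (simp_all add: scaleC_add_left scaleR_scaleC scaleC_scaleC norm_scaleC scaleR_conv_of_real)
    then have "continuous_on {0..1} (\<lambda>r. (c n * of_real r ^ n) *\<^sub>C zpow n)" for n
      by (rule bounded_linear.continuous_on) (intro continuous_intros)
    then show "\<forall>\<^sub>F N in sequentially. continuous_on {0..1} (G N)"
      unfolding G_def[abs_def] by (intro always_eventually allI continuous_on_sum)
  qed simp
  define F where "F z = (\<Sum>n. c n * z ^ n)" for z
  have F: "(\<lambda>n. c n * z ^ n) sums F z" if "z \<in> ball 0 1" for z
  proof -
    \<comment> \<open>Square summable coefficients are bounded, so Abel's lemma at radius 1 gives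
      convergence in the whole open disc.\<close>
    have "Bseq (\<lambda>n. (cmod (c n))\<^sup>2)"
      using c by (intro convergent_imp_Bseq convergentI[OF summable_LIMSEQ_zero])
    then obtain K where K: "\<And>n. (cmod (c n))\<^sup>2 \<le> K"
      by (auto simp: Bseq_def)
    have "norm (c n) * 1 ^ n \<le> sqrt K" for n
      using real_le_rsqrt[OF K] by simp
    from Abel_lemma[OF _ _ this, of "norm z"] have "summable (\<lambda>n. norm (c n) * norm z ^ n)"
      using that by simp
    then have "summable (\<lambda>n. c n * z ^ n)"
      by (intro summable_norm_cancel[of "\<lambda>n. c n * z ^ n"]) (simp add: norm_mult norm_power)
    then show ?thesis unfolding F_def by (rule summable_sums)
  qed
  have dil: "dilate F r = g r" if r: "r \<in> {0..<1}" for r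
  proof (rule LIMSEQ_unique)
    show "(\<lambda>N. G N r) \<longlonglongrightarrow> g r" using r by (intro lim) auto
    then have "Cauchy (\<lambda>N. G N r)"
      using LIMSEQ_imp_Cauchy by blast
    then show "(\<lambda>N. G N r) \<longlonglongrightarrow> dilate F r"
      unfolding G_def using F r by (intro dilate_power_series) auto
  qed
  have "bounded (g ` {0..1})"
    using cont by (intro compact_imp_bounded compact_continuous_image) auto
  then obtain C where "\<And>r. r \<in> {0..1} \<Longrightarrow> norm (g r) \<le> C"
    by (metis bounded_iff imageI)
  then have "\<forall>r\<in>{0..<1}. norm (dilate F r) \<le> C"
    using dil by simp
  moreover have "F holomorphic_on ball 0 1"
    using F by (intro power_series_holomorphic[of 0 1 c]) simp
  ultimately have "F \<in> hardy_functions"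
    unfolding hardy_functions_iff by blast
  moreover have "(dilate F \<longlongrightarrow> g 1) (at_left 1)"
  proof (rule Lim_transform_eventually)
    have "(g \<longlongrightarrow> g 1) (at 1 within {0..1})"
      using cont by (simp add: continuous_on)
    then show "(g \<longlongrightarrow> g 1) (at_left 1)"
      by (simp add: at_within_Icc_at_left)
    show "\<forall>\<^sub>F r in at_left 1. g r = dilate F r"
      using eventually_at_left_1 by eventually_elim (simp add: dil)
  qed
  ultimately have "g 1 \<in> hardy_space"
    unfolding hardy_space_def by blast
  moreover have "(\<lambda>N. \<Sum>n<N. c n *\<^sub>C zpow n) \<longlonglongrightarrow> g 1"
    using lim[of 1] by (simp add: G_def)
  ultimately show ?thesis by (rule that)
qed

section \<open>Existence of the orthogonal projection\<close>

lemma hardy_space_diff: "x \<in> hardy_space \<Longrightarrow> y \<in> hardy_space \<Longrightarrow> x - y \<in> hardy_space"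
  unfolding minus_L2_def uminus_L2_def by (intro hardy_space_add hardy_space_scaleC)

lemma bessel_inequality:
  assumes "finite A"
  shows "(\<Sum>n\<in>A. (cmod (cinner x (zpow n)))\<^sup>2) \<le> (norm x)\<^sup>2"
proof -
  define s where "s = (\<Sum>n\<in>A. cinner x (zpow n) *\<^sub>C zpow n)"
  define b where "b = (\<Sum>n\<in>A. (cmod (cinner x (zpow n)))\<^sup>2)"
  have "cinner x s = complex_of_real b"
    by (simp add: s_def b_def cinner_sum_right cinner_scaleC_right complex_norm_square mult.commute
        del: of_real_power)
  then have "inner x s = b"
    by (simp add: inner_eq_Re_cinner)
  moreover have "(norm s)\<^sup>2 = b"
    unfolding s_def b_def by (rule norm_sum_zpow[OF assms])
  ultimately have "(norm (x - s))\<^sup>2 = (norm x)\<^sup>2 - b"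
    by (simp add: power2_norm_eq_inner inner_diff_left inner_diff_right inner_commute)
  then show ?thesis unfolding b_def[symmetric]
    by (metis diff_ge_0_iff_ge zero_le_power2)
qed

text \<open>The projection keeps the Fourier coefficients of nonnegative index: Bessel's inequality
  makes them square summable, so they define an element \<open>p\<close> of the Hardy space. Then
  \<open>x - p\<close> is orthogonal to every \<open>zpow k\<close>, hence to the whole
  space.\<close>

lemma hardy_projection_exists:
  obtains p where "p \<in> hardy_space" "\<And>m. m \<in> hardy_space \<Longrightarrow> cinner (x - p) m = 0"
proof -
  have "summable (\<lambda>n. (cmod (cinner x (zpow n)))\<^sup>2)"
    using bessel_inequality by (intro bounded_imp_summable[where B = "(norm x)\<^sup>2"]) auto
  then obtain p where p: "p \<in> hardy_space" "(\<lambda>N. \<Sum>n<N. cinner x (zpow n) *\<^sub>C zpow n) \<longlonglongrightarrow> p"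
    by (rule hardy_space_of_square_summable)
  have "cinner p (zpow k) = cinner x (zpow k)" for k
  proof (rule LIMSEQ_unique)
    show "(\<lambda>N. cinner (\<Sum>n<N. cinner x (zpow n) *\<^sub>C zpow n) (zpow k)) \<longlonglongrightarrow> cinner p (zpow k)"
      by (rule bounded_linear.tendsto[OF bounded_linear_cinner_left p(2)])
    have "\<forall>\<^sub>F N in sequentially. cinner (\<Sum>n<N. cinner x (zpow n) *\<^sub>C zpow n) (zpow k) = cinner x (zpow k)"
      using eventually_gt_at_top[of k]
    proof eventually_elim
      case (elim N)
      then show ?case
        by (simp add: cinner_sum_left cinner_scaleC_left cinner_zpow if_distrib[of "\<lambda>x. _ * x"] cong: if_cong)
    qed
    then show "(\<lambda>N. cinner (\<Sum>n<N. cinner x (zpow n) *\<^sub>C zpow n) (zpow k)) \<longlonglongrightarrow> cinner x (zpow k)"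
      by (rule tendsto_eventually)
  qed
  then have "cinner (x - p) (zpow k) = 0" for k
    by (simp add: cinner_diff_left)
  then have "cinner (zpow k) (x - p) = 0" for k
    by (metis cinner_commute complex_cnj_zero)
  then have "cinner (x - p) m = 0" if "m \<in> hardy_space" for m
    using cinner_hardy_space_eq_0[OF _ that] by (metis cinner_commute complex_cnj_zero)
  with p(1) show ?thesis by (rule that)
qed


section \<open>The Hankel operator and the shift\<close>

text \<open>The projection with values in the subtype \<open>H2\<close>, a common factor of the
  Hankel operator and of the adjoint of the shift.\<close>

definition hardy_proj :: "L2 \<Rightarrow> H2" where
  "hardy_proj x = Abs_H2 (orth_proj hardy_space x)"

lemma cinner_H2: "cinner f g = cinner (Rep_H2 f) (Rep_H2 g)"
  by transfer simp

lemma norm_H2: "norm f = norm (Rep_H2 f)"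
  by transfer simp

text \<open>The projection is the adjoint of the inclusion \<open>Rep_H2\<close>. Linearity, the
  bound 1 and the matrix entries below are all drawn from this identity.\<close>

lemma cinner_hardy_proj: "cinner (hardy_proj x) g = cinner x (Rep_H2 g)"
proof -
  obtain p where p: "p \<in> hardy_space" "\<And>m. m \<in> hardy_space \<Longrightarrow> cinner (x - p) m = 0"
    using hardy_projection_exists[of x] by blast
  then have "orth_proj hardy_space x = p"
    by (intro orth_proj_eqI hardy_space_diff)
  then have "Rep_H2 (hardy_proj x) = p"
    using p(1) by (simp add: hardy_proj_def Abs_H2_inverse)
  then show ?thesis
    using p(2)[OF Rep_H2[of g]] by (simp add: cinner_H2 cinner_diff_left)
qed

lemma cinner_left_cancel:
  assumes "\<And>z. cinner x z = cinner y z" shows "x = y"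
  using assms by (intro cinner_right_cancel) (metis cinner_commute)

lemma bounded_operatorI:
  assumes "\<And>x y. T (x + y) = T x + T y" "\<And>c x. T (c *\<^sub>C x) = c *\<^sub>C T x"
    "\<And>x. norm (T x) \<le> norm x * K"
  shows "bounded_operator T"
  unfolding bounded_operator_def
proof
  show "bounded_linear T"
    by (rule bounded_linear_intro[where K = K]) (simp_all add: assms scaleR_scaleC)
qed (simp add: assms)

lemma bounded_operator_comp:
  assumes "bounded_operator S" "bounded_operator T"
  shows "bounded_operator (\<lambda>x. S (T x))"
  using assms bounded_linear_compose[of S T] by (simp add: bounded_operator_def)

lemma norm_le_of_cinner:
  assumes "\<And>y. cmod (cinner x y) \<le> K * norm y" "K \<ge> 0"
  shows "norm x \<le> K"
proof (cases "norm x = 0")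
  case False
  have "(norm x)\<^sup>2 \<le> K * norm x"
    using assms(1)[of x] unfolding cinner_self by (simp del: of_real_power)
  then show ?thesis using False by (simp add: power2_eq_square)
qed (use assms in simp)

lemma bounded_operator_hardy_proj: "bounded_operator hardy_proj"
proof (rule bounded_operatorI[where K = 1])
  show "norm (hardy_proj x) \<le> norm x * 1" for x
    using cmod_cinner_le[of x]
    by (intro norm_le_of_cinner) (simp_all add: cinner_hardy_proj norm_H2)
qed (intro cinner_left_cancel; simp add: cinner_hardy_proj cinner_add_left cinner_scaleC_left)+

lemma bounded_operator_Rep_H2: "bounded_operator Rep_H2"
  by (rule bounded_operatorI[where K = 1]) (simp_all add: plus_H2.rep_eq scaleC_H2.rep_eq norm_H2)

lemma square_integrable_cnj:
  assumes "f \<in> square_integrable" shows "(\<lambda>z. f (cnj z)) \<in> square_integrable"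
proof -
  have "integrable (distr circle_measure circle_measure cnj) (\<lambda>z. (cmod (f z))\<^sup>2)"
    using assms by (simp add: distr_circle_measure_cnj square_integrable_def)
  then have "integrable circle_measure (\<lambda>z. (cmod (f (cnj z)))\<^sup>2)"
    by (rule integrable_distr[OF measurable_cnj_circle])
  moreover have "(\<lambda>z. f (cnj z)) \<in> borel_measurable circle_measure"
    by (rule measurable_compose[OF measurable_cnj_circle square_integrable_measurable[OF assms]])
  ultimately show ?thesis by (simp add: square_integrable_def)
qed

lemma reflect_L2_of:
  "f \<in> square_integrable \<Longrightarrow> reflect_L2 (L2_of f) = L2_of (\<lambda>z. f (cnj z))"
  by transfer (simp add: l2rel_def square_integrable_cnj)

text \<open>Reflection is isometric because conjugation preserves arc length on the circle.\<close>

lemma bounded_operator_reflect_L2: "bounded_operator reflect_L2"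
proof (rule bounded_operatorI[where K = 1])
  fix x y c
  obtain f g where f: "f \<in> square_integrable" "x = L2_of f"
    and g: "g \<in> square_integrable" "y = L2_of g"
    using L2_of_surj by metis
  show "reflect_L2 (x + y) = reflect_L2 x + reflect_L2 y"
    using f g by (simp add: reflect_L2_of square_integrable_cnj square_integrable_add flip: L2_of_add)
  show "reflect_L2 (c *\<^sub>C x) = c *\<^sub>C reflect_L2 x"
    using f by (simp add: reflect_L2_of square_integrable_cnj square_integrable_cmult flip: L2_of_cmult)
  have "(norm (reflect_L2 x))\<^sup>2 = (\<integral>z. (cmod (f (cnj z)))\<^sup>2 \<partial>circle_measure)"
    using f by (simp add: reflect_L2_of norm_L2_of square_integrable_cnj)
  also have "\<dots> = (\<integral>z. (cmod (f z))\<^sup>2 \<partial>distr circle_measure circle_measure cnj)"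
  proof (rule integral_distr[OF measurable_cnj_circle, symmetric])
    show "(\<lambda>z. (cmod (f z))\<^sup>2) \<in> borel_measurable circle_measure"
      using square_integrable_measurable[OF f(1)] by measurable
  qed
  also have "\<dots> = (norm x)\<^sup>2"
    using f by (simp add: distr_circle_measure_cnj norm_L2_of)
  finally show "norm (reflect_L2 x) \<le> norm x * 1"
    by (simp add: power2_eq_iff_nonneg)
qed

lemma hankel_eq: "hankel \<phi> f = hardy_proj (mult_L2 \<phi> (reflect_L2 (Rep_H2 f)))"
  by (simp add: hankel_def hardy_proj_def)

lemma bounded_operator_hankel: "bounded_operator (hankel \<phi>)"
  unfolding hankel_eq[abs_def]
  by (intro bounded_operator_comp[OF bounded_operator_hardy_proj]
      bounded_operator_comp[OF bounded_operator_mult_L2]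
      bounded_operator_comp[OF bounded_operator_reflect_L2] bounded_operator_Rep_H2)

section \<open>Matrix entries, the adjoint of the shift and the test vectors\<close>

lemma Rep_monomial: "Rep_H2 (monomial n) = zpow n"
  by (simp add: monomial.rep_eq zpow_def)

lemma cinner_monomial: "cinner (monomial m) (monomial n) = (if m = n then 1 else 0)"
  by (simp add: cinner_H2 Rep_monomial cinner_zpow)

text \<open>The monomials are total in \<open>H2\<close>; identities can therefore be checked on
  coefficients.\<close>

lemma cinner_monomial_cancel:
  assumes "\<And>n. cinner (monomial n) x = cinner (monomial n) y" shows "x = y"
proof (rule cinner_right_cancel)
  fix z
  have "cinner (zpow n) (Rep_H2 x - Rep_H2 y) = 0" for n
    using assms[of n] by (simp add: cinner_H2 Rep_monomial cinner_diff_right)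
  from cinner_hardy_space_eq_0[OF this Rep_H2[of z]]
  show "cinner z x = cinner z y"
    by (simp add: cinner_H2 cinner_diff_right)
qed

text \<open>Reflection turns \<open>z ^ j\<close> into \<open>cnj z ^ j\<close>, and pairing with
  \<open>z ^ i\<close> contributes \<open>cnj z ^ i\<close>. So the entry is the Fourier coefficient
  of \<phi> of index \<open>i + j\<close>.\<close>

lemma cinner_hankel_monomial:
  assumes \<phi>: "\<phi> \<in> L_infinity"
  shows "cinner (hankel \<phi> (monomial j)) (monomial i)
    = (\<integral>z. \<phi> z * cnj z ^ (i + j) \<partial>circle_measure)"
proof -
  have sq: "(\<lambda>z. cnj z ^ j) \<in> square_integrable"
    by (intro square_integrable_continuous continuous_intros)
  have "cinner (hankel \<phi> (monomial j)) (monomial i)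
      = cinner (L2_of (\<lambda>z. \<phi> z * cnj z ^ j)) (zpow i)"
    using \<phi> sq
    by (simp add: hankel_eq cinner_hardy_proj Rep_monomial zpow_def[of j] reflect_L2_of
        square_integrable_power L2_of_mult)
  also have "\<dots> = (\<integral>z. \<phi> z * cnj z ^ j * cnj (z ^ i) \<partial>circle_measure)"
    unfolding zpow_def
    by (intro cinner_L2_of square_integrable_mult \<phi> sq square_integrable_power)
  also have "(\<lambda>z. \<phi> z * cnj z ^ j * cnj (z ^ i)) = (\<lambda>z. \<phi> z * cnj z ^ (i + j))"
    by (simp add: power_add mult_ac)
  finally show ?thesis .
qed

lemma mult_L2_adjoint:
  assumes \<phi>: "\<phi> \<in> L_infinity"
  shows "cinner (mult_L2 \<phi> x) y = cinner x (mult_L2 (\<lambda>z. cnj (\<phi> z)) y)"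
proof -
  obtain f g where f: "f \<in> square_integrable" "x = L2_of f"
    and g: "g \<in> square_integrable" "y = L2_of g"
    using L2_of_surj by metis
  have \<phi>': "(\<lambda>z. cnj (\<phi> z)) \<in> L_infinity"
    using \<phi> unfolding L_infinity_def by auto
  have "cinner (mult_L2 \<phi> x) y = (\<integral>z. \<phi> z * f z * cnj (g z) \<partial>circle_measure)"
    using f g \<phi> by (simp add: L2_of_mult[symmetric] cinner_L2_of square_integrable_mult)
  also have "(\<lambda>z. \<phi> z * f z * cnj (g z)) = (\<lambda>z. f z * cnj (cnj (\<phi> z) * g z))"
    by (simp add: mult_ac)
  also have "(\<integral>z. f z * cnj (cnj (\<phi> z) * g z) \<partial>circle_measure)
      = cinner x (mult_L2 (\<lambda>z. cnj (\<phi> z)) y)"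
    unfolding f(2) g(2) L2_of_mult[OF \<phi>' g(1), symmetric]
    by (intro cinner_L2_of[symmetric] square_integrable_mult f(1) g(1) \<phi>')
  finally show ?thesis .
qed

lemma id_L_infinity: "(\<lambda>z. z) \<in> L_infinity"
  by (intro L_infinity_continuous continuous_intros)

text \<open>The adjoint is exhibited as multiplication by \<open>cnj z\<close> followed by the
  projection. This shows that the definite description \<open>cadjoint shift\<close> really denotes
  an adjoint.\<close>

lemma cinner_shift: "cinner (shift x) y = cinner x (cadjoint shift y)"
proof -
  have *: "cinner (shift x) y = cinner x (hardy_proj (mult_L2 cnj (Rep_H2 y)))" for x y
  proof -
    have "cinner (shift x) y = cinner (Rep_H2 x) (mult_L2 cnj (Rep_H2 y))"
      by (simp add: cinner_H2 shift.rep_eq mult_L2_adjoint[OF id_L_infinity])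
    also have "\<dots> = cinner x (hardy_proj (mult_L2 cnj (Rep_H2 y)))"
      by (metis cinner_commute cinner_hardy_proj)
    finally show ?thesis .
  qed
  then have "cadjoint shift = (\<lambda>y. hardy_proj (mult_L2 cnj (Rep_H2 y)))"
    by (rule cadjoint_eqI)
  with * show ?thesis by simp
qed

lemma shift_monomial: "shift (monomial n) = monomial (Suc n)"
proof -
  have "Rep_H2 (shift (monomial n)) = L2_of (\<lambda>z. z * z ^ n)"
    unfolding shift.rep_eq Rep_monomial zpow_def
    by (rule L2_of_mult[OF id_L_infinity square_integrable_power, symmetric])
  then have "Rep_H2 (shift (monomial n)) = Rep_H2 (monomial (Suc n))"
    by (simp add: Rep_monomial zpow_def)
  then show ?thesis by (simp add: Rep_H2_inject)
qed

text \<open>The test vectors \<open>v_m\<close>: all coefficients are nonnegative, and the backward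
  shift permits passing from each to the previous one.\<close>

definition monomial_sum :: "nat \<Rightarrow> H2" where
  "monomial_sum m = (\<Sum>j<m. monomial j)"

lemma cinner_monomial_sum: "cinner (monomial n) (monomial_sum m) = (if n < m then 1 else 0)"
  by (simp add: monomial_sum_def cinner_sum_right cinner_monomial)

lemma norm_monomial_sum: "(norm (monomial_sum m))\<^sup>2 = real m"
proof -
  have "cinner (monomial_sum m) (monomial_sum m) = (\<Sum>j<m. cinner (monomial j) (monomial_sum m))"
    by (subst (1) monomial_sum_def) (rule cinner_sum_left)
  also have "\<dots> = complex_of_real (real m)"
    by (simp add: cinner_monomial_sum)
  finally show ?thesis unfolding cinner_self of_real_eq_iff .
qed

text \<open>Moving the shift onto \<open>monomial n\<close> reduces the claim to the equivalence of
  \<open>Suc n < m\<close> and \<open>n < m - 1\<close>. Truncated subtraction covers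
  \<open>m = 0\<close>, where both sides vanish.\<close>

lemma cadjoint_shift_monomial_sum: "cadjoint shift (monomial_sum m) = monomial_sum (m - 1)"
  by (rule cinner_monomial_cancel)
     (auto simp: cinner_shift[symmetric] shift_monomial cinner_monomial_sum)

section \<open>The Hilbert matrix\<close>

text \<open>The growth argument sees the operator through its matrix; the locale separates it from
  the computations with the symbol \<psi>.\<close>

locale hilbert_hankel =
  fixes H :: "H2 \<Rightarrow> H2"
  assumes bounded: "bounded_operator H"
    and matrix: "\<And>i j. cinner (H (monomial j)) (monomial i) = 1 / of_nat (i + j + 1)"
begin

text \<open>The pairing sums \<open>m * p\<close> matrix entries, and \<open>i + j + 1\<close> stays
  below \<open>m + p\<close> throughout.\<close>

lemma Re_cinner_monomial_sum_ge:
  "Re (cinner (H (monomial_sum m)) (monomial_sum p)) \<ge> real m * real p / real (m + p)"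
proof -
  have "linear H"
    using bounded by (simp add: bounded_operator_def bounded_linear.linear)
  then have "H (monomial_sum m) = (\<Sum>j<m. H (monomial j))"
    unfolding monomial_sum_def by (rule linear_sum)
  then have "cinner (H (monomial_sum m)) (monomial_sum p)
      = (\<Sum>j<m. \<Sum>i<p. complex_of_real (1 / real (i + j + 1)))"
    by (simp add: monomial_sum_def[of p] cinner_sum_left cinner_sum_right matrix)
       (rule sum.swap)
  then have "Re (cinner (H (monomial_sum m)) (monomial_sum p))
      = (\<Sum>j<m. \<Sum>i<p. 1 / real (i + j + 1))"
    by (simp only: Re_sum Re_complex_of_real)
  also have "\<dots> \<ge> (\<Sum>j<m. \<Sum>i<p. 1 / real (m + p))"
    by (intro sum_mono divide_left_mono) auto
  finally show ?thesis by simp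
qed

lemma Re_cinner_power_ge:
  assumes "n \<le> N"
  defines "T \<equiv> upper_triangular shift H (cadjoint shift)"
  shows "Re (cinner (fst ((T ^^ n) (0, monomial_sum N))) (monomial_sum n))
    \<ge> (\<Sum>k<n. (real N - real k) * (real k + 1) / (real N + 1))"
  using assms(1)
proof (induction n)
  case (Suc n)
  \<comment> \<open>The second component evolves under the backward shift alone.\<close>
  have snd: "snd ((T ^^ k) (0, monomial_sum N)) = monomial_sum (N - k)" for k
    by (induction k)
       (simp_all add: T_def upper_triangular_def case_prod_beta cadjoint_shift_monomial_sum)
  have "fst ((T ^^ Suc n) (0, monomial_sum N))
      = shift (fst ((T ^^ n) (0, monomial_sum N))) + H (monomial_sum (N - n))"
    by (simp add: snd[symmetric]) (simp add: T_def upper_triangular_def case_prod_beta)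
  then have "Re (cinner (fst ((T ^^ Suc n) (0, monomial_sum N))) (monomial_sum (Suc n)))
      = Re (cinner (fst ((T ^^ n) (0, monomial_sum N))) (monomial_sum n))
        + Re (cinner (H (monomial_sum (N - n))) (monomial_sum (Suc n)))"
    by (simp only: cinner_add_left cinner_shift cadjoint_shift_monomial_sum diff_Suc_1 plus_complex.sel)
  moreover have "Re (cinner (H (monomial_sum (N - n))) (monomial_sum (Suc n)))
      \<ge> (real N - real n) * (real n + 1) / (real N + 1)"
    using Re_cinner_monomial_sum_ge[of "N - n" "Suc n"] Suc.prems
    by (simp add: of_nat_diff algebra_simps)
  ultimately show ?case
    using Suc by simp
qed simp

lemma not_similar_to_contraction:
  "\<not> similar_to_contraction (upper_triangular shift H (cadjoint shift))"
proof
  define T where "T = upper_triangular shift H (cadjoint shift)"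
  assume "similar_to_contraction (upper_triangular shift H (cadjoint shift))"
  then obtain K where K: "\<And>n x. norm ((T ^^ n) x) \<le> K * norm x"
    using power_bounded_if_similar_to_contraction unfolding T_def by blast
  have "real N + 2 \<le> 6 * K" if "N > 0" for N
  proof -
    let ?v = "monomial_sum N" and ?x = "fst ((T ^^ N) (0, monomial_sum N))"
    \<comment> \<open>The upper limit \<open>n\<close> is independent of \<open>N\<close> so that
      induction applies. At \<open>n = N\<close> the value is \<open>N (N + 1) (N + 2) / 6\<close>,
      and \<open>N + 1\<close> cancels against the denominator.\<close>
    have sum: "(\<Sum>k<n. (real N - real k) * (real k + 1))
        = real n * (real n + 1) * (3 * real N - 2 * real n + 2) / 6" for n
      by (induction n) (simp_all add: field_simps)
    have "real N * (real N + 2) / 6 = (\<Sum>k<N. (real N - real k) * (real k + 1) / (real N + 1))"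
      unfolding sum_divide_distrib[symmetric] sum by (simp add: field_simps)
    also have "\<dots> \<le> Re (cinner ?x ?v)"
      unfolding T_def by (rule Re_cinner_power_ge) simp
    also have "\<dots> \<le> norm ?x * norm ?v"
      using norm_cauchy_schwarz[of ?x ?v] by (simp add: inner_eq_Re_cinner)
    also have "\<dots> \<le> (K * norm ?v) * norm ?v"
    proof (rule mult_right_mono)
      show "norm ?x \<le> K * norm ?v"
        using norm_fst_le[of ?x "snd ((T ^^ N) (0, ?v))"] K[of N "(0, ?v)"]
        by (simp add: norm_Pair)
    qed simp
    also have "\<dots> = K * real N"
      by (simp add: norm_monomial_sum mult.assoc flip: power2_eq_square)
    finally have "real N * (real N + 2) \<le> real N * (6 * K)" by (simp add: field_simps)
    then show ?thesis using that by (simp only: mult_le_cancel_left_pos of_nat_0_less_iff)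
  qed
  \<comment> \<open>The maximum with 0 ensures \<open>N > 0\<close> whatever the sign of
    \<open>K\<close>.\<close>
  moreover obtain N where "real N > max 0 (6 * K)"
    using reals_Archimedean2 by blast
  ultimately show False by (smt (verit) of_nat_0_less_iff)
qed

end

section \<open>The symbol of the Hilbert matrix\<close>

text \<open>The angle \<open>t\<close> runs through all of the circle, so the formula bounds \<psi>
  by \<open>pi\<close>. Measurability comes from a formula in \<open>z\<close> that is continuous
  away from the jump at 1.\<close>

lemma hilbert_symbol_L_infinity:
  assumes \<psi>: "\<And>t. t \<in> {0..<2 * pi} \<Longrightarrow> \<psi> (cis t) = \<i> * cis (- t) * complex_of_real (pi - t)"
  shows "\<psi> \<in> L_infinity"
proof -
  have cis_ex: "\<exists>t\<in>{0..<2 * pi}. z = cis t" if "z \<in> space circle_measure" for z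
  proof
    show "z = cis (Arg2pi z)"
      using that complex_norm_eq_1_exp[of z] by (simp add: cis_conv_exp)
    show "Arg2pi z \<in> {0..<2 * pi}"
      using Arg2pi[of z] by simp
  qed
  \<comment> \<open>The principal argument of \<open>- z\<close> equals \<open>t - pi\<close>, with
    its cut exactly at \<open>z = 1\<close>. There the value \<open>\<i> * pi\<close>, taken at
    \<open>t = 0\<close>, is added separately.\<close>
  define g where "g z = indicator (sphere 0 1 - {1}) z *\<^sub>R (- \<i> * cnj z * complex_of_real (Arg (- z)))
    + indicator {1} z *\<^sub>R (\<i> * complex_of_real pi)" for z
  have "continuous_on (sphere 0 1 - {1}) (\<lambda>z. - \<i> * cnj z * complex_of_real (Arg (- z)))"
  proof (intro continuous_intros)
    fix z :: complex assume z: "z \<in> sphere 0 1 - {1}"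
    show "- z \<notin> \<real>\<^sub>\<le>\<^sub>0"
    proof
      assume "- z \<in> \<real>\<^sub>\<le>\<^sub>0"
      then have "Re z \<ge> 0" "Im z = 0" by (auto simp: complex_nonpos_Reals_iff)
      with z show False by (auto simp: cmod_def complex_eq_iff)
    qed
  qed
  then have "g \<in> borel_measurable borel"
    unfolding g_def
    by (intro borel_measurable_add borel_measurable_continuous_on_indicator) auto
  then have "g \<in> borel_measurable (restrict_space borel (sphere 0 1))"
    by (rule measurable_restrict_space1)
  then have "g \<in> borel_measurable circle_measure"
    by (simp only: measurable_cong_sets[OF sets_circle_measure refl])
  moreover have "\<psi> z = g z" if "z \<in> space circle_measure" for z
  proof -
    from cis_ex[OF that] obtain t where t: "t \<in> {0..<2 * pi}" "z = cis t"
      by blast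
    show ?thesis
    proof (cases "t = 0")
      case True
      then show ?thesis using \<psi>[of 0] t by (simp add: g_def)
    next
      case False
      have "- z = cis (t - pi)"
        by (simp add: t complex_eq_iff)
      moreover have "t - pi \<in> {-pi<..pi}" using t False by auto
      ultimately have A: "Arg (- z) = t - pi"
        by (simp add: Arg_cis)
      \<comment> \<open>At \<open>z = 1\<close> the argument of \<open>- z\<close> would be
        \<open>pi\<close>, forcing \<open>t = 2 * pi\<close>, which lies outside the
        interval.\<close>
      have "z \<noteq> 1"
        using A t(1) Arg_cis[of pi] by auto
      then have "g z = - \<i> * cnj z * complex_of_real (t - pi)"
        using that A by (simp add: g_def)
      also have "\<dots> = \<i> * cis (- t) * complex_of_real (pi - t)"
        by (simp add: t(2) cis_cnj algebra_simps)
      finally show ?thesis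
        using \<psi>[OF t(1)] t(2) by simp
    qed
  qed
  ultimately have "\<psi> \<in> borel_measurable circle_measure"
    using measurable_cong[of circle_measure \<psi> g borel] by blast
  moreover have bound: "cmod (\<psi> z) \<le> pi" if "z \<in> space circle_measure" for z
  proof -
    from cis_ex[OF that] obtain t where t: "t \<in> {0..<2 * pi}" "z = cis t"
      by blast
    then have "cmod (\<psi> z) = \<bar>pi - t\<bar>"
      by (simp add: \<psi> norm_mult del: of_real_diff)
    then show ?thesis using t(1) by auto
  qed
  ultimately show ?thesis
    unfolding L_infinity_def using AE_I2[OF bound] by blast
qed

lemma hilbert_symbol_moment:
  assumes \<psi>: "\<And>t. t \<in> {0..<2 * pi} \<Longrightarrow> \<psi> (cis t) = \<i> * cis (- t) * complex_of_real (pi - t)"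
  shows "(\<integral>z. \<psi> z * cnj z ^ n \<partial>circle_measure) = 1 / of_nat (n + 1)"
proof -
  \<comment> \<open>The factor \<open>cis (- t)\<close> of the symbol raises the frequency from
    \<open>n\<close> to \<open>n + 1\<close>.\<close>
  define m where "m = real (n + 1)"
  have m: "m > 0" by (simp add: m_def)
  define g where "g t = \<i> * cis (- m * t) * complex_of_real (pi - t)" for t
  \<comment> \<open>The primitive of \<open>g\<close> obtained by integrating the factor
    \<open>pi - t\<close> by parts.\<close>
  define G where "G t = (- (complex_of_real (pi - t) / m) - \<i> / m\<^sup>2) * cis (- m * t)" for t
  have m1: "\<psi> \<in> borel_measurable circle_measure"
    using hilbert_symbol_L_infinity[OF \<psi>] by (simp add: L_infinity_def)
  have "(\<integral>z. \<psi> z * cnj z ^ n \<partial>circle_measure) = (G (2 * pi) - G 0) / (2 * pi)"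
  proof (rule integral_circle_measure_FTC)
    show "(\<lambda>z. \<psi> z * cnj z ^ n) \<in> borel_measurable circle_measure"
      by (intro borel_measurable_times m1 circle_measurableI continuous_intros)
    show "\<psi> (cis t) * cnj (cis t) ^ n = g t" if "t \<in> {0..<2 * pi}" for t
    proof -
      have "cis (- t) * cnj (cis t) ^ n = cis (- t + real n * - t)"
        by (simp only: cis_cnj Complex.DeMoivre cis_mult)
      also have "- t + real n * - t = - m * t"
        by (simp add: m_def algebra_simps)
      finally have "cis (- t) * cnj (cis t) ^ n = cis (- m * t)" .
      then show ?thesis unfolding \<psi>[OF that] g_def by (metis mult.assoc mult.commute)
    qed
    show "continuous_on {0..2 * pi} g"
      unfolding g_def by (intro continuous_intros)
    show "(G has_vector_derivative g t) (at t)" for t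
    proof -
      have "((\<lambda>t. - (complex_of_real (pi - t) / m) - \<i> / m\<^sup>2) has_vector_derivative 1 / m) (at t)"
        using has_vector_derivative_real_field[of "\<lambda>z. - ((pi - z) / m) - \<i> / m\<^sup>2" "1 / m" t UNIV]
        by (auto intro!: derivative_eq_intros)
      from has_vector_derivative_mult[OF this has_vector_derivative_cis[of "- m" t]]
      moreover have "(- (complex_of_real (pi - t) / m) - \<i> / m\<^sup>2) * (\<i> * complex_of_real (- m) * cis (- m * t))
          + 1 / m * cis (- m * t) = g t"
        using m unfolding g_def by (simp add: field_simps power2_eq_square)
      ultimately show ?thesis
        unfolding G_def by simp
    qed
  qed
  moreover have "cis (- m * (2 * pi)) = 1"
    using cis_multiple_2pi[of "- m"] by (simp add: m_def mult_ac)
  \<comment> \<open>Periodicity cancels the constant term of \<open>G\<close>; what survives is the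
    change of \<open>pi - t\<close> from \<open>pi\<close> to \<open>- pi\<close>.\<close>
  then have "G (2 * pi) - G 0 = 2 * pi / m"
    by (simp add: G_def add_divide_distrib[symmetric])
  ultimately have "(\<integral>z. \<psi> z * cnj z ^ n \<partial>circle_measure) = complex_of_real (1 / m)"
    by simp
  then show ?thesis
    by (simp add: m_def)
qed

text \<open>Membership in \<open>L_infinity\<close> certifies that the Hankel operator is the
  intended one, since \<open>mult_L2\<close> is 0 for any other symbol. The matrix entries then
  identify it with the Hilbert matrix.\<close>

theorem corollary6p2:
  fixes \<psi> :: "complex \<Rightarrow> complex"
  assumes "\<And>t. t \<in> {0..<2 * pi} \<Longrightarrow> \<psi> (cis t) = \<i> * cis (- t) * complex_of_real (pi - t)"
  shows "\<psi> \<in> L_infinity \<and>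
    bounded_operator (hankel \<psi>) \<and>
    (\<forall>i j. cinner (hankel \<psi> (monomial j)) (monomial i) = 1 / of_nat (i + j + 1)) \<and>
    \<not> similar_to_contraction (upper_triangular shift (hankel \<psi>) (cadjoint shift))"
proof -
  have L: "\<psi> \<in> L_infinity"
    using assms by (rule hilbert_symbol_L_infinity)
  have "cinner (hankel \<psi> (monomial j)) (monomial i) = 1 / of_nat (i + j + 1)" for i j
    using hilbert_symbol_moment[OF assms] by (simp add: cinner_hankel_monomial[OF L])
  then interpret hilbert_hankel "hankel \<psi>"
    by unfold_locales (simp_all add: bounded_operator_hankel)
  show ?thesis
    using L bounded matrix not_similar_to_contraction by blast
qed

end
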